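(* Let $N\ge2$, let $\mathcal{Q}_N=\mathbb{R}[\varepsilon]/(\varepsilon^{N^2-1})$, and let $\Psi_{\mathcal{Q}_N}:\mathbb{P}(\mathcal{H}^N)\to\mathcal{Q}_N$ be the generalized density map $$\Psi_{\mathcal{Q}_N}(\rho)=\left(\tfrac1N+x_1\right)+x_2\varepsilon+x_3\varepsilon^2+\dots+x_{N^2-1}\varepsilon^{N^2-2},$$ where the real numbers $x_1,\dots,x_{N^2-1}$ are determined by $\rho=\frac1N\mathbb{I}_N+\sqrt{\frac{N-1}{2N}}\sum_{i=1}^{N^2-1}x_i\lambda_i$. Then $\Psi_{\mathcal{Q}_N}$ is a globally injective smooth embedding, and it is a diffeomorphism from the complex projective space $\mathbb{P}(\mathcal{H}^N)\cong\mathbb{CP}^{N-1}$ onto a compact real algebraic subvariety $\mathcal{V}_{\mathcal{Q}_N}=\Psi_{\mathcal{Q}_N}(\mathbb{P}(\mathcal{H}^N))$, of real dimension $2N-2$, of the $(N^2-1)$-dimensional real vector space $\mathcal{Q}_N$.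
   Context: $\mathcal{H}^N=\mathbb{C}^N$, and $\mathbb{P}(\mathcal{H}^N)$ is the space of complex lines in $\mathbb{C}^N$. A point represented by a unit vector $|\psi\rangle$ is identified with the rank-one Hermitian projector $\rho=|\psi\rangle\langle\psi|$. The matrices $\lambda_1,\dots,\lambda_{N^2-1}$ are the generalized Gell-Mann matrices in a fixed order: they form a real basis of the traceless Hermitian $N\times N$ matrices and satisfy $\mathrm{Tr}(\lambda_j\lambda_k)=2\delta_{jk}$. The algebra $\mathcal{Q}_N$ is regarded as a real vector space with basis $\{1,\varepsilon,\dots,\varepsilon^{N^2-2}\}$, giving its smooth and real-algebraic structure as an affine space. *)

theory Defs
  imports
    "HOL-Analysis.Analysis"
    "HOL-Computational_Algebra.Polynomial"
    "HOL-Library.Cardinality"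
begin

section \<open>The algebra $\mathbb{R}[\varepsilon]/(\varepsilon^{N^2-1})$\<close>

text \<open>
  Throughout, \<open>N = CARD('n)\<close>; the type class \<open>card2\<close> says exactly that \<open>'n\<close> is finite with
  \<open>N \<ge> 2\<close>.
\<close>

definition trunc_rel :: "'n::card2 itself \<Rightarrow> real poly \<Rightarrow> real poly \<Rightarrow> bool" where
  "trunc_rel _ p q \<longleftrightarrow> [:0, 1:] ^ (CARD('n)\<^sup>2 - 1) dvd p - q"

lemma trunc_rel_iff:
  "trunc_rel TYPE('n::card2) p q \<longleftrightarrow> (\<forall>i < CARD('n)\<^sup>2 - 1. coeff p i = coeff q i)"
proof -
  have "[:0, 1:] ^ (CARD('n)\<^sup>2 - 1) = (monom 1 (CARD('n)\<^sup>2 - 1) :: real poly)"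
    by (metis monom_altdef smult_1_left)
  then show ?thesis
    by (simp add: trunc_rel_def monom_1_dvd_iff')
qed

lemma trunc_dim_pos: "CARD('n::card2)\<^sup>2 - 1 > 0"
proof -
  have "(2::nat)\<^sup>2 \<le> CARD('n)\<^sup>2"
    by (rule power_mono) (simp_all add: two_le_card)
  then show ?thesis by simp
qed

quotient_type (overloaded) 'n trunc_poly = "real poly" / "trunc_rel TYPE('n::card2)"
  by (rule equivpI; rule reflpI sympI transpI; auto simp: trunc_rel_iff)

instantiation trunc_poly :: (card2) comm_ring_1
begin

lift_definition zero_trunc_poly :: "'a trunc_poly" is 0 .
lift_definition one_trunc_poly :: "'a trunc_poly" is 1 .
lift_definition plus_trunc_poly :: "'a trunc_poly \<Rightarrow> 'a trunc_poly \<Rightarrow> 'a trunc_poly" is "(+)"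
  by (simp add: trunc_rel_iff)
lift_definition minus_trunc_poly :: "'a trunc_poly \<Rightarrow> 'a trunc_poly \<Rightarrow> 'a trunc_poly" is "(-)"
  by (simp add: trunc_rel_iff)
lift_definition uminus_trunc_poly :: "'a trunc_poly \<Rightarrow> 'a trunc_poly" is uminus
  by (simp add: trunc_rel_iff)
lift_definition times_trunc_poly :: "'a trunc_poly \<Rightarrow> 'a trunc_poly \<Rightarrow> 'a trunc_poly" is "(*)"
  by (simp add: trunc_rel_iff coeff_mult)

instance
proof
  show "(0 :: 'a trunc_poly) \<noteq> 1"
    using trunc_dim_pos[where 'n = 'a] by transfer (auto simp: trunc_rel_iff intro!: exI[of _ 0])
qed (transfer; simp add: trunc_rel_iff algebra_simps)+

end

instantiation trunc_poly :: (card2) real_algebra_1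
begin

lift_definition scaleR_trunc_poly :: "real \<Rightarrow> 'a trunc_poly \<Rightarrow> 'a trunc_poly" is smult
  by (simp add: trunc_rel_iff)

instance
  by standard (transfer; simp add: trunc_rel_iff algebra_simps smult_add_left smult_add_right)+

end

lift_definition eps :: "'n::card2 trunc_poly" is "[:0, 1:]" .

lemma eps_power: "(eps :: 'n::card2 trunc_poly) ^ i = abs_trunc_poly (monom 1 i)"
proof (induction i)
  case 0
  then show ?case by (simp add: one_trunc_poly_def monom_0 one_pCons)
next
  case (Suc i)
  then show ?case
    by (simp add: eps_def times_trunc_poly.abs_eq monom_Suc)
qed

text \<open>
  The topology and the smooth and real algebraic structure of the affine space are those of the
  Euclidean space with orthonormal basis \<open>1, \<epsilon>, \<dots>, \<epsilon>\<^bsup>N\<^sup>2-2\<^esup>\<close>.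
\<close>

instantiation trunc_poly :: (card2) real_inner
begin

lift_definition inner_trunc_poly :: "'a trunc_poly \<Rightarrow> 'a trunc_poly \<Rightarrow> real" is
  "\<lambda>p q. \<Sum>i < CARD('a)\<^sup>2 - 1. coeff p i * coeff q i"
  by (simp add: trunc_rel_iff)

definition norm_trunc_poly :: "'a trunc_poly \<Rightarrow> real" where
  "norm (x :: 'a trunc_poly) = sqrt (inner x x)"

definition sgn_trunc_poly :: "'a trunc_poly \<Rightarrow> 'a trunc_poly" where
  "sgn (x :: 'a trunc_poly) = x /\<^sub>R norm x"

definition dist_trunc_poly :: "'a trunc_poly \<Rightarrow> 'a trunc_poly \<Rightarrow> real" where
  "dist (x :: 'a trunc_poly) y = norm (x - y)"

definition uniformity_trunc_poly :: "('a trunc_poly \<times> 'a trunc_poly) filter" where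
  "(uniformity :: ('a trunc_poly \<times> 'a trunc_poly) filter) = (INF e\<in>{0<..}. principal {(x :: 'a trunc_poly, y). dist x y < e})"

definition open_trunc_poly :: "'a trunc_poly set \<Rightarrow> bool" where
  "open (U :: 'a trunc_poly set) \<longleftrightarrow> (\<forall>x\<in>U. eventually (\<lambda>(x', y). x' = x \<longrightarrow> y \<in> U) uniformity)"

instance
proof
  fix x y z :: "'a trunc_poly" and r :: real
  show "inner x y = inner y x"
    by transfer (simp add: mult.commute)
  show "inner (x + y) z = inner x z + inner y z"
    by transfer (simp add: algebra_simps sum.distrib)
  show "inner (r *\<^sub>R x) y = r * inner x y"
    by transfer (simp add: sum_distrib_left mult.assoc)
  show "0 \<le> inner x x"
    by transfer (simp add: sum_nonneg)
  show "inner x x = 0 \<longleftrightarrow> x = 0"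
    by transfer (auto simp: trunc_rel_iff sum_nonneg_eq_0_iff)
qed (auto simp: norm_trunc_poly_def sgn_trunc_poly_def dist_trunc_poly_def
    uniformity_trunc_poly_def open_trunc_poly_def)

end

lemma inner_eps_power:
  assumes "i < CARD('n)\<^sup>2 - 1"
  shows "inner (abs_trunc_poly p) ((eps :: 'n::card2 trunc_poly) ^ i) = coeff p i"
  using assms by (simp add: eps_power inner_trunc_poly.abs_eq if_distrib cong: if_cong)

lemma inner_eps_power_eps_power:
  assumes "i < CARD('n)\<^sup>2 - 1" "j < CARD('n)\<^sup>2 - 1"
  shows "inner ((eps :: 'n::card2 trunc_poly) ^ i) (eps ^ j) = (if i = j then 1 else 0)"
  using assms by (subst eps_power[of i]) (simp add: inner_eps_power)

instantiation trunc_poly :: (card2) euclidean_space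
begin

definition Basis_trunc_poly :: "'a trunc_poly set" where
  "(Basis :: 'a trunc_poly set) = (\<lambda>i. eps ^ i) ` {..< CARD('a)\<^sup>2 - 1}"

instance
proof
  show "(Basis :: 'a trunc_poly set) \<noteq> {}"
    using trunc_dim_pos[where 'n = 'a] by (auto simp: Basis_trunc_poly_def lessThan_empty_iff simp del: zero_less_diff)
  show "finite (Basis :: 'a trunc_poly set)"
    by (simp add: Basis_trunc_poly_def)
  fix x :: "'a trunc_poly"
  obtain p where x: "x = abs_trunc_poly p"
    using Quotient3_abs_rep[OF Quotient3_trunc_poly, of x] by metis
  show "(\<forall>u\<in>Basis. inner x u = 0) \<longleftrightarrow> x = 0"
    by (auto simp: x Basis_trunc_poly_def inner_eps_power zero_trunc_poly_def
        trunc_poly.abs_eq_iff trunc_rel_iff)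
next
  fix u v :: "'a trunc_poly"
  assume "u \<in> Basis" "v \<in> Basis"
  then obtain i j where ij: "u = eps ^ i" "v = eps ^ j"
    "i < CARD('a)\<^sup>2 - 1" "j < CARD('a)\<^sup>2 - 1"
    by (auto simp: Basis_trunc_poly_def)
  show "inner u v = (if u = v then 1 else 0)"
    using inner_eps_power_eps_power[OF ij(3,4)] inner_eps_power_eps_power[OF ij(3,3)]
    by (cases "i = j") (auto simp: ij(1,2))
qed

end

section \<open>Complex projective space\<close>

definition proj_space :: "(complex ^ 'n) set set" where
  "proj_space = {L. vec.subspace L \<and> vec.dim L = 1}"

text \<open>The quotient topology along $v \mapsto \mathbb{C}v$ on the nonzero vectors.\<close>

definition proj_topology :: "(complex ^ 'n) set topology" where
  "proj_topology = topology (\<lambda>W. W \<subseteq> proj_space \<and> open {v. v \<noteq> 0 \<and> vec.span {v} \<in> W})"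

lemma openin_proj_topology:
  fixes W :: "(complex ^ 'n) set set"
  shows "openin proj_topology W \<longleftrightarrow> W \<subseteq> proj_space \<and> open {v. v \<noteq> 0 \<and> vec.span {v} \<in> W}"
proof -
  have "istopology (\<lambda>W. W \<subseteq> proj_space \<and> open {v :: complex ^ 'n. v \<noteq> 0 \<and> vec.span {v} \<in> W})"
    unfolding istopology_def
  proof (intro conjI allI impI)
    fix S T :: "(complex ^ 'n) set set"
    assume S: "S \<subseteq> proj_space \<and> open {v. v \<noteq> 0 \<and> vec.span {v} \<in> S}"
      and T: "T \<subseteq> proj_space \<and> open {v. v \<noteq> 0 \<and> vec.span {v} \<in> T}"
    show "S \<inter> T \<subseteq> proj_space" using S by blast
    have "{v. v \<noteq> 0 \<and> vec.span {v} \<in> S \<inter> T} =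
        {v. v \<noteq> 0 \<and> vec.span {v} \<in> S} \<inter> {v. v \<noteq> 0 \<and> vec.span {v} \<in> T}" by blast
    then show "open {v. v \<noteq> 0 \<and> vec.span {v} \<in> S \<inter> T}"
      using S T by auto
  next
    fix K :: "(complex ^ 'n) set set set"
    assume K: "\<forall>S\<in>K. S \<subseteq> proj_space \<and> open {v. v \<noteq> 0 \<and> vec.span {v} \<in> S}"
    show "\<Union>K \<subseteq> proj_space" using K by blast
    have "{v. v \<noteq> 0 \<and> vec.span {v} \<in> \<Union>K} = (\<Union>S\<in>K. {v. v \<noteq> 0 \<and> vec.span {v} \<in> S})" by blast
    then show "open {v. v \<noteq> 0 \<and> vec.span {v} \<in> \<Union>K}"
      using K by auto
  qed
  then show ?thesis
    by (simp add: proj_topology_def)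
qed

text \<open>
  The affine charts: on the lines not contained in \<open>z\<^sub>j = 0\<close> the coordinates are
  \<open>(z\<^sub>i / z\<^sub>j)\<close> for \<open>i \<noteq> j\<close>.  The model space $\mathbb{C}^{N-1}$ is the linear
  subspace \<open>{w. w\<^sub>j = 0}\<close>, i.e. the omitted coordinate \<open>j\<close> is set to \<open>0\<close>.
\<close>

definition affine_dom :: "'n \<Rightarrow> (complex ^ 'n) set set" where
  "affine_dom j = {L \<in> proj_space. \<exists>z\<in>L. z $ j \<noteq> 0}"

definition affine_coord :: "'n \<Rightarrow> (complex ^ 'n) set \<Rightarrow> complex ^ 'n" where
  "affine_coord j L = (THE w. \<exists>z\<in>L. z $ j \<noteq> 0 \<and> w = (\<chi> i. if i = j then 0 else z $ i / z $ j))"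

definition proj_atlas :: "((complex ^ 'n) set set \<times> ((complex ^ 'n) set \<Rightarrow> complex ^ 'n)) set" where
  "proj_atlas = range (\<lambda>j. (affine_dom j, affine_coord j))"

section \<open>Smooth maps\<close>

primrec Ck_on :: "nat \<Rightarrow> 'a::euclidean_space set \<Rightarrow> ('a \<Rightarrow> 'b::euclidean_space) \<Rightarrow> bool" where
  "Ck_on 0 U f \<longleftrightarrow> continuous_on U f"
| "Ck_on (Suc k) U f \<longleftrightarrow> (\<forall>x\<in>U. f differentiable (at x)) \<and>
     (\<forall>v. Ck_on k U (\<lambda>x. frechet_derivative f (at x) v))"

text \<open>
  Smoothness on an arbitrary subset means that, locally, there is a smooth extension to an open
  set of the ambient space.  On (relatively) open subsets of a linear subspace this is ordinary
  smoothness.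
\<close>

definition smooth_on :: "'a::euclidean_space set \<Rightarrow> ('a \<Rightarrow> 'b::euclidean_space) \<Rightarrow> bool" where
  "smooth_on A f \<longleftrightarrow> (\<forall>x\<in>A. \<exists>U g. open U \<and> x \<in> U \<and> (\<forall>k. Ck_on k U g) \<and> (\<forall>y\<in>A \<inter> U. g y = f y))"

text \<open>
  A chart of a \<open>d\<close>-dimensional manifold is a pair \<open>(U, \<phi>)\<close>, where \<open>\<phi>\<close> maps \<open>U\<close> onto a relatively
  open subset of some \<open>d\<close>-dimensional linear subspace of a Euclidean space.
\<close>

type_synonym ('p, 'e) atlas = "('p set \<times> ('p \<Rightarrow> 'e)) set"

definition smooth_map ::
    "'p topology \<Rightarrow> ('p, 'e::euclidean_space) atlas \<Rightarrow>
     'q topology \<Rightarrow> ('q, 'f::euclidean_space) atlas \<Rightarrow> ('p \<Rightarrow> 'q) \<Rightarrow> bool" where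
  "smooth_map X \<A> Y \<B> f \<longleftrightarrow> continuous_map X Y f \<and>
     (\<forall>(U, \<phi>)\<in>\<A>. \<forall>(V, \<psi>)\<in>\<B>. smooth_on (\<phi> ` (U \<inter> f -` V)) (\<psi> \<circ> f \<circ> inv_into U \<phi>))"

definition diffeomorphism ::
    "'p topology \<Rightarrow> ('p, 'e::euclidean_space) atlas \<Rightarrow>
     'q topology \<Rightarrow> ('q, 'f::euclidean_space) atlas \<Rightarrow> ('p \<Rightarrow> 'q) \<Rightarrow> bool" where
  "diffeomorphism X \<A> Y \<B> f \<longleftrightarrow> bij_betw f (topspace X) (topspace Y) \<and>
     smooth_map X \<A> Y \<B> f \<and> smooth_map Y \<B> X \<A> (inv_into (topspace X) f)"

text \<open>
  Since \<open>\<phi> ` U\<close> is open in a linear subspace \<open>S\<close>, the tangent space \<open>S\<close> of \<open>\<phi> ` U\<close> is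
  \<open>span (\<phi> ` U)\<close>.
\<close>

definition immersion ::
    "('p, 'e::euclidean_space) atlas \<Rightarrow> ('p \<Rightarrow> 'f::euclidean_space) \<Rightarrow> bool" where
  "immersion \<A> f \<longleftrightarrow> (\<forall>(U, \<phi>)\<in>\<A>. \<forall>p\<in>U. \<exists>D.
     (f \<circ> inv_into U \<phi> has_derivative D) (at (\<phi> p) within \<phi> ` U) \<and> inj_on D (span (\<phi> ` U)))"

definition smooth_embedding ::
    "'p topology \<Rightarrow> ('p, 'e::euclidean_space) atlas \<Rightarrow> ('p \<Rightarrow> 'f::euclidean_space) \<Rightarrow> bool" where
  "smooth_embedding X \<A> f \<longleftrightarrow>
     smooth_map X \<A> euclidean {(UNIV, id)} f \<and> immersion \<A> f \<and> embedding_map X euclidean f"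

section \<open>Embedded submanifolds and real algebraic sets\<close>

text \<open>All local diffeomorphisms of \<open>M\<close>, with its subspace topology, to $\mathbb{R}^d$.\<close>

definition submanifold_atlas :: "nat \<Rightarrow> 'e::euclidean_space set \<Rightarrow> ('e, 'e) atlas" where
  "submanifold_atlas d M = {(U, \<phi>). \<exists>S. subspace S \<and> dim S = d \<and>
     openin (top_of_set M) U \<and> openin (top_of_set S) (\<phi> ` U) \<and> inj_on \<phi> U \<and>
     smooth_on U \<phi> \<and> smooth_on (\<phi> ` U) (inv_into U \<phi>)}"

definition embedded_submanifold :: "nat \<Rightarrow> 'e::euclidean_space set \<Rightarrow> bool" where
  "embedded_submanifold d M \<longleftrightarrow> M \<subseteq> \<Union> (fst ` submanifold_atlas d M)"

definition real_algebraic_set :: "'e::euclidean_space set \<Rightarrow> bool" where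
  "real_algebraic_set V \<longleftrightarrow>
     (\<exists>P. finite P \<and> (\<forall>p\<in>P. real_polynomial_function p) \<and> V = {x. \<forall>p\<in>P. p x = 0})"

text \<open>
  The dimension of a nonempty, possibly singular, real algebraic set: the largest dimension of
  a nonempty smooth submanifold of the ambient space contained in it.
\<close>

definition real_dimension :: "'e::euclidean_space set \<Rightarrow> nat" where
  "real_dimension V = Max {d. \<exists>M \<subseteq> V. M \<noteq> {} \<and> embedded_submanifold d M}"

section \<open>The generalized density map\<close>

text \<open>The matrix unit with entry \<open>1\<close> in position \<open>(j, k)\<close>.\<close>

definition matrix_unit :: "'n \<Rightarrow> 'n \<Rightarrow> complex ^ 'n ^ 'n" where
  "matrix_unit j k = (\<chi> a b. if a = j \<and> b = k then 1 else 0)"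

definition gell_mann_sym :: "'n \<Rightarrow> 'n \<Rightarrow> complex ^ 'n ^ 'n" where
  "gell_mann_sym j k = matrix_unit j k + matrix_unit k j"

definition gell_mann_asym :: "'n \<Rightarrow> 'n \<Rightarrow> complex ^ 'n ^ 'n" where
  "gell_mann_asym j k = (\<chi> a b. - \<i> * matrix_unit j k $ a $ b + \<i> * matrix_unit k j $ a $ b)"

text \<open>
  With \<open>l\<close> the number of indices below \<open>k\<close>, this is
  $\sqrt{2/(l(l+1))}\,\mathrm{diag}(1,\dots,1,-l,0,\dots,0)$.
\<close>

definition gell_mann_diag :: "'n::{finite, linorder} \<Rightarrow> complex ^ 'n::{finite, linorder} ^ 'n::{finite, linorder}" where
  "gell_mann_diag k = (let l = real (card {..<k}) in
     sqrt (2 / (l * (l + 1))) *\<^sub>R ((\<Sum>j<k. matrix_unit j j) - l *\<^sub>R matrix_unit k k))"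

definition gell_mann_matrices :: "(complex ^ 'n::{finite, linorder} ^ 'n::{finite, linorder}) set" where
  "gell_mann_matrices =
     {gell_mann_sym j k | j k. j < k} \<union> {gell_mann_asym j k | j k. j < k} \<union>
     {gell_mann_diag k | k. \<exists>j. j < k}"

definition ketbra :: "complex ^ 'n \<Rightarrow> complex ^ 'n ^ 'n" where
  "ketbra \<psi> = (\<chi> a b. \<psi> $ a * cnj (\<psi> $ b))"

definition line_projector :: "(complex ^ 'n) set \<Rightarrow> complex ^ 'n ^ 'n" where
  "line_projector L = (THE \<rho>. \<exists>\<psi>\<in>L. norm \<psi> = 1 \<and> \<rho> = ketbra \<psi>)"

definition bloch_coords :: "(nat \<Rightarrow> complex ^ 'n ^ 'n) \<Rightarrow> complex ^ 'n ^ 'n \<Rightarrow> nat \<Rightarrow> real" where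
  "bloch_coords lam \<rho> = (THE x. (\<forall>i. i \<notin> {1..CARD('n)\<^sup>2 - 1} \<longrightarrow> x i = 0) \<and>
     \<rho> = (1 / real CARD('n)) *\<^sub>R mat 1 +
       sqrt ((real CARD('n) - 1) / (2 * real CARD('n))) *\<^sub>R
         (\<Sum>i = 1..CARD('n)\<^sup>2 - 1. x i *\<^sub>R lam i))"

definition density_map ::
    "(nat \<Rightarrow> complex ^ 'n::card2 ^ 'n::card2) \<Rightarrow> (complex ^ 'n::card2) set \<Rightarrow> 'n trunc_poly" where
  "density_map lam L = (let x = bloch_coords lam (line_projector L) in
     of_real (1 / real CARD('n) + x 1) + (\<Sum>i = 2..CARD('n)\<^sup>2 - 1. x i *\<^sub>R eps ^ (i - 1)))"

end

theory Submission
  imports Defs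
begin

text \<open>
  Up to an affine change of coordinates, \<open>\<Psi>\<close> is the map sending a line to its orthogonal projector:
  the Gell-Mann matrices are an orthogonal basis of the traceless Hermitian matrices, so the Bloch
  coordinates identify the Hermitian matrices of trace \<open>1\<close> affinely with $\mathcal{Q}_N$.
  Under this identification the image consists of the matrices all of whose \<open>2 \<times> 2\<close> minors
  vanish, which is a polynomial condition.  In the affine chart \<open>z\<^sub>j = 1\<close> the map is
  \<open>z \<mapsto> z z\<^sup>* / |z|\<^sup>2\<close>, with the smooth left inverse \<open>A \<mapsto> (A\<^sub>i\<^sub>j / A\<^sub>j\<^sub>j)\<^sub>i\<close> defined on a
  neighbourhood of its image; this yields the immersion property, charts of the image and smoothness
  of the inverse.  Invariance of domain bounds the dimension of submanifolds of the image.
\<close>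

section \<open>Smooth maps\<close>

text \<open>The definitions impose three constraints. \<open>Ck_on\<close> iterates derivatives in
  fixed directions, so sum, product, chain and reciprocal rules are proved by induction on the
  order. All maps that occur then reduce to linear maps, products and reciprocals, because dividing
  \<open>ketbra v\<close> by \<open>v \<bullet> v\<close> avoids the square root hidden in
  normalising \<open>v\<close>. Smoothness on the model space \<open>w $ j = 0\<close>, which has
  empty interior, asks for extensions to open sets. Parametrisations and charts are therefore given
  by formulas valid on open subsets of the ambient spaces, and the chart inverts the parametrisation
  only up to the projection that clears coordinate \<open>j\<close>. Finally, the smooth structure
  of the image consists of all its charts, with values in subspaces of the algebra itself. The
  explicit charts must be transported there by a linear isomorphism, and the diffeomorphism must be
  checked against arbitrary charts.\<close>

lemma Ck_on_SucD:
  assumes "Ck_on (Suc k) U f" "x \<in> U"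
  shows "(f has_derivative frechet_derivative f (at x)) (at x)"
  using assms by (simp add: frechet_derivative_works)

text \<open>On an open set, functions that agree on the set agree near each of its points, so their
  derivatives agree there too and the induction can pass to them.\<close>

lemma Ck_on_cong:
  assumes "open U" "\<And>x. x \<in> U \<Longrightarrow> f x = g x" "Ck_on k U f"
  shows "Ck_on k U g"
  using assms(2,3)
proof (induction k arbitrary: f g)
  case 0
  then show ?case
    using continuous_on_cong[of U U f g] by simp
next
  case (Suc k)
  have D: "(g has_derivative frechet_derivative f (at x)) (at x)" if "x \<in> U" for x
    by (rule has_derivative_transform_within_open[OF Ck_on_SucD[OF Suc.prems(2) that] assms(1) that Suc.prems(1)])
  have "Ck_on k U (\<lambda>x. frechet_derivative g (at x) v)" for v
  proof (rule Suc.IH)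
    show "Ck_on k U (\<lambda>x. frechet_derivative f (at x) v)"
      using Suc.prems(2) by simp
    show "frechet_derivative f (at x) v = frechet_derivative g (at x) v" if "x \<in> U" for x
      using frechet_derivative_at[OF D[OF that]] by simp
  qed
  then show ?case
    using D by (auto simp: differentiable_def)
qed

text \<open>Derivatives at a point are unique, so any explicit formula \<open>f'\<close> may replace
  the chosen \<open>frechet_derivative\<close>. All differentiation rules below go through
  this.\<close>

lemma Ck_on_SucI:
  assumes "open U" "\<And>x. x \<in> U \<Longrightarrow> (f has_derivative f' x) (at x)"
    and "\<And>v. Ck_on k U (\<lambda>x. f' x v)"
  shows "Ck_on (Suc k) U f"
proof -
  have "Ck_on k U (\<lambda>x. frechet_derivative f (at x) v)" for v
    by (rule Ck_on_cong[OF assms(1) _ assms(3)]) (simp add: frechet_derivative_at[OF assms(2), symmetric])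
  then show ?thesis
    using assms(2) by (auto simp: differentiable_def)
qed

lemma Ck_on_SucE: "Ck_on (Suc k) U f \<Longrightarrow> Ck_on k U f"
proof (induction k arbitrary: f)
  case 0
  then show ?case
    by (simp add: differentiable_imp_continuous_on differentiable_at_imp_differentiable_on)
qed simp

lemma Ck_on_imp_continuous_on: "Ck_on k U f \<Longrightarrow> continuous_on U f"
  by (induction k) (auto intro: differentiable_imp_continuous_on differentiable_at_imp_differentiable_on)

lemma Ck_on_subset: "Ck_on k U f \<Longrightarrow> W \<subseteq> U \<Longrightarrow> Ck_on k W f"
  by (induction k arbitrary: f) (auto intro: continuous_on_subset)

lemma Ck_on_const: "open U \<Longrightarrow> Ck_on k U (\<lambda>x. c)"
proof (induction k arbitrary: c)
  case (Suc k)
  then show ?case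
    by (intro Ck_on_SucI[where f' = "\<lambda>x v. 0"]) auto
qed simp

lemma Ck_on_bounded_linear:
  assumes "bounded_linear h" "open U"
  shows "Ck_on k U h"
proof (cases k)
  case 0
  then show ?thesis
    using assms by (simp add: linear_continuous_on)
next
  case (Suc m)
  show ?thesis
    unfolding Suc
    by (rule Ck_on_SucI[OF assms(2) bounded_linear_imp_has_derivative[OF assms(1)] Ck_on_const[OF assms(2)]])
qed

lemma Ck_on_add:
  assumes "open U" "Ck_on k U f" "Ck_on k U g"
  shows "Ck_on k U (\<lambda>x. f x + g x)"
  using assms(2,3)
proof (induction k arbitrary: f g)
  case 0
  then show ?case
    by (simp add: continuous_on_add)
next
  case (Suc k)
  show ?case
  proof (rule Ck_on_SucI[OF assms(1)])
    show "((\<lambda>x. f x + g x) has_derivative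
        (\<lambda>v. frechet_derivative f (at x) v + frechet_derivative g (at x) v)) (at x)" if "x \<in> U" for x
      using Suc.prems that by (intro has_derivative_add Ck_on_SucD)
  qed (use Suc in simp)
qed

lemma Ck_on_sum:
  assumes "open U" "\<And>i. i \<in> I \<Longrightarrow> Ck_on k U (f i)"
  shows "Ck_on k U (\<lambda>x. \<Sum>i\<in>I. f i x)"
  using assms(2)
  by (induction I rule: infinite_finite_induct) (auto intro: Ck_on_const Ck_on_add assms(1))

text \<open>Both terms of the product rule are again values of \<open>prod\<close>, at functions of
  one order less; hence the induction generalises \<open>f\<close> and \<open>g\<close>. Scaling,
  multiplication, inner products and outer products are all instances.\<close>

lemma Ck_on_bilinear:
  fixes f :: "'a::euclidean_space \<Rightarrow> 'b::euclidean_space" and g :: "'a \<Rightarrow> 'c::euclidean_space"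
    and prod :: "'b \<Rightarrow> 'c \<Rightarrow> 'd::euclidean_space"
  assumes "bounded_bilinear prod" "open U" "Ck_on k U f" "Ck_on k U g"
  shows "Ck_on k U (\<lambda>x. prod (f x) (g x))"
  using assms(3,4)
proof (induction k arbitrary: f g)
  case 0
  then show ?case
    by (simp add: bounded_bilinear.continuous_on[OF assms(1)])
next
  case (Suc k)
  show ?case
  proof (rule Ck_on_SucI[OF assms(2)])
    show "((\<lambda>x. prod (f x) (g x)) has_derivative
        (\<lambda>v. prod (f x) (frechet_derivative g (at x) v) + prod (frechet_derivative f (at x) v) (g x))) (at x)"
      if "x \<in> U" for x
      using Suc.prems that by (intro bounded_bilinear.FDERIV[OF assms(1)] Ck_on_SucD)
    show "Ck_on k U (\<lambda>x. prod (f x) (frechet_derivative g (at x) v) +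
        prod (frechet_derivative f (at x) v) (g x))" for v
    proof (intro Ck_on_add[OF assms(2)] Suc.IH)
      show "Ck_on k U f" "Ck_on k U g"
        using Suc.prems by (auto intro: Ck_on_SucE simp del: Ck_on.simps)
      show "Ck_on k U (\<lambda>x. frechet_derivative f (at x) v)" "Ck_on k U (\<lambda>x. frechet_derivative g (at x) v)"
        using Suc.prems by simp_all
    qed
  qed
qed

text \<open>In the chain rule the derivative of \<open>g\<close> is applied to a direction that
  varies with \<open>x\<close>, whereas \<open>Ck_on\<close> controls fixed directions only.
  Expanding that direction in \<open>Basis\<close> leaves products of scalar functions with
  directional derivatives of \<open>g\<close> composed with \<open>f\<close>, and the induction
  hypothesis covers the latter because \<open>g\<close> is generalised.\<close>

lemma Ck_on_compose:
  fixes f :: "'a::euclidean_space \<Rightarrow> 'b::euclidean_space" and g :: "'b \<Rightarrow> 'c::euclidean_space"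
  assumes "open U" "f ` U \<subseteq> W" "Ck_on k U f" "Ck_on k W g"
  shows "Ck_on k U (\<lambda>x. g (f x))"
  using assms(3,4)
proof (induction k arbitrary: g)
  case 0
  then show ?case
    using assms(2) continuous_on_compose2[of W g U f] by simp
next
  case (Suc k)
  let ?f = "\<lambda>x. frechet_derivative f (at x)" and ?g = "\<lambda>y. frechet_derivative g (at y)"
  have g: "(g has_derivative ?g (f x)) (at (f x))" if "x \<in> U" for x
    using that assms(2) by (intro Ck_on_SucD[OF Suc.prems(2)]) auto
  show ?case
  proof (rule Ck_on_SucI[OF assms(1)])
    show "((\<lambda>x. g (f x)) has_derivative (\<lambda>v. \<Sum>b\<in>Basis. (?f x v \<bullet> b) *\<^sub>R ?g (f x) b)) (at x)"
      if "x \<in> U" for x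
    proof -
      have "((\<lambda>x. g (f x)) has_derivative (\<lambda>v. ?g (f x) (?f x v))) (at x)"
        using diff_chain_at[OF Ck_on_SucD[OF Suc.prems(1) that] g[OF that]] by (simp add: o_def)
      moreover have "?g (f x) w = (\<Sum>b\<in>Basis. (w \<bullet> b) *\<^sub>R ?g (f x) b)" for w
      proof -
        have lin: "linear (?g (f x))"
          using g[OF that] by (rule has_derivative_linear)
        have "?g (f x) w = ?g (f x) (\<Sum>b\<in>Basis. (w \<bullet> b) *\<^sub>R b)"
          by (simp only: euclidean_representation)
        also have "\<dots> = (\<Sum>b\<in>Basis. (w \<bullet> b) *\<^sub>R ?g (f x) b)"
          by (simp only: linear_sum[OF lin] linear_cmul[OF lin])
        finally show ?thesis .
      qed
      then have "(\<lambda>v. ?g (f x) (?f x v)) = (\<lambda>v. \<Sum>b\<in>Basis. (?f x v \<bullet> b) *\<^sub>R ?g (f x) b)"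
        by (intro ext)
      ultimately show ?thesis
        by (simp only:)
    qed
    show "Ck_on k U (\<lambda>x. \<Sum>b\<in>Basis. (?f x v \<bullet> b) *\<^sub>R ?g (f x) b)" for v
    proof -
      have f: "Ck_on k U (\<lambda>x. ?f x v)"
        using Suc.prems(1) by simp
      have g: "Ck_on k U (\<lambda>x. ?g (f x) b)" for b
        using Suc.prems(2) by (intro Suc.IH[OF Ck_on_SucE[OF Suc.prems(1)], of "\<lambda>y. ?g y b"]) simp
      show ?thesis
        by (rule Ck_on_sum[OF assms(1) Ck_on_bilinear[OF bounded_bilinear_scaleR assms(1)
          Ck_on_bilinear[OF bounded_bilinear_inner assms(1) f Ck_on_const[OF assms(1)]] g]])
    qed
  qed
qed

lemma Ck_on_bounded_linear_compose:
  fixes f :: "'a::euclidean_space \<Rightarrow> 'b::euclidean_space" and h :: "'b \<Rightarrow> 'c::euclidean_space"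
  assumes "bounded_linear h" "open U" "Ck_on k U f"
  shows "Ck_on k U (\<lambda>x. h (f x))"
  by (rule Ck_on_compose[OF assms(2) subset_UNIV assms(3) Ck_on_bounded_linear[OF assms(1) open_UNIV]])

text \<open>The derivative of the reciprocal contains only the reciprocal itself and the derivative
  of \<open>f\<close>, so each order of smoothness bootstraps the next.\<close>

lemma Ck_on_inverse:
  fixes f :: "'a::euclidean_space \<Rightarrow> real"
  assumes "open U" "\<And>x. x \<in> U \<Longrightarrow> f x \<noteq> 0" "Ck_on k U f"
  shows "Ck_on k U (\<lambda>x. inverse (f x))"
  using assms(3)
proof (induction k)
  case 0
  then show ?case
    using assms(2) by (auto intro: continuous_on_inverse)
next
  case (Suc k)
  show ?case
  proof (rule Ck_on_SucI[OF assms(1)])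
    show "((\<lambda>x. inverse (f x)) has_derivative
        (\<lambda>v. - 1 * (inverse (f x) * frechet_derivative f (at x) v * inverse (f x)))) (at x)"
      if "x \<in> U" for x
      using Deriv.has_derivative_inverse[OF assms(2)[OF that] Ck_on_SucD[OF Suc.prems that]] by simp
    show "Ck_on k U (\<lambda>x. - 1 * (inverse (f x) * frechet_derivative f (at x) v * inverse (f x)))" for v
      using Suc.prems Suc.IH[OF Ck_on_SucE[OF Suc.prems]]
      by (intro Ck_on_bilinear[OF bounded_bilinear_mult assms(1)] Ck_on_const[OF assms(1)]) simp_all
  qed
qed

section \<open>Smoothness on arbitrary subsets\<close>

lemma smooth_onI:
  assumes "open U" "A \<subseteq> U" "\<And>k. Ck_on k U g" "\<And>x. x \<in> A \<Longrightarrow> g x = f x"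
  shows "smooth_on A f"
  unfolding smooth_on_def
proof
  fix x assume "x \<in> A"
  show "\<exists>U g. open U \<and> x \<in> U \<and> (\<forall>k. Ck_on k U g) \<and> (\<forall>y\<in>A \<inter> U. g y = f y)"
    by (rule exI[of _ U], rule exI[of _ g]) (use assms \<open>x \<in> A\<close> in \<open>simp add: subset_iff\<close>)
qed

lemma smooth_on_subset:
  assumes "smooth_on A f" "B \<subseteq> A"
  shows "smooth_on B f"
  unfolding smooth_on_def
proof
  fix x assume "x \<in> B"
  then obtain U g where "open U" "x \<in> U" "\<forall>k. Ck_on k U g" "\<forall>y\<in>A \<inter> U. g y = f y"
    using assms unfolding smooth_on_def by (meson subsetD)
  then show "\<exists>U g. open U \<and> x \<in> U \<and> (\<forall>k. Ck_on k U g) \<and> (\<forall>y\<in>B \<inter> U. g y = f y)"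
    using assms(2) by (intro exI[of _ U] exI[of _ g]) (simp add: subset_iff)
qed

lemma smooth_on_cong: "(\<And>x. x \<in> A \<Longrightarrow> f x = g x) \<Longrightarrow> smooth_on A f = smooth_on A g"
  unfolding smooth_on_def by simp

lemma smooth_on_imp_continuous_on:
  assumes "smooth_on A f"
  shows "continuous_on A f"
  unfolding continuous_on_eq_continuous_within
proof
  fix x assume "x \<in> A"
  then obtain U g where U: "open U" "x \<in> U" "Ck_on 0 U g" "\<And>y. y \<in> A \<inter> U \<Longrightarrow> g y = f y"
    using assms unfolding smooth_on_def by metis
  then have "continuous (at x within A) g"
    by (auto simp: continuous_on_eq_continuous_at intro: continuous_at_imp_continuous_at_within)
  moreover have "\<forall>\<^sub>F y in at x within A. g y = f y"
    unfolding eventually_at_topological using U by blast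
  ultimately show "continuous (at x within A) f"
    using U \<open>x \<in> A\<close> by (auto simp: continuous_within intro: Lim_transform_eventually)
qed

lemma smooth_on_compose:
  assumes "smooth_on A f" "smooth_on B g" "f ` A \<subseteq> B"
  shows "smooth_on A (g \<circ> f)"
  unfolding smooth_on_def
proof
  fix x assume "x \<in> A"
  then obtain U f' where U: "open U" "x \<in> U" "\<And>k. Ck_on k U f'" "\<And>y. y \<in> A \<inter> U \<Longrightarrow> f' y = f y"
    using assms(1) unfolding smooth_on_def by metis
  have "f x \<in> B"
    using \<open>x \<in> A\<close> assms(3) by blast
  then obtain W g' where W: "open W" "f x \<in> W" "\<And>k. Ck_on k W g'" "\<And>y. y \<in> B \<inter> W \<Longrightarrow> g' y = g y"
    using assms(2) unfolding smooth_on_def by metis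
  have cont: "continuous_on U f'"
    using U(3)[of 0] by simp
  \<comment> \<open>The extension \<open>f'\<close> may leave \<open>W\<close> away from
    \<open>A\<close>, so its domain is shrunk to the part that is mapped into
    \<open>W\<close>.\<close>
  define U' where "U' = U \<inter> f' -` W"
  have "open U'"
    unfolding U'_def using continuous_open_preimage[OF cont U(1) W(1)] .
  moreover have "x \<in> U'"
    using U W \<open>x \<in> A\<close> by (simp add: U'_def)
  moreover have "Ck_on k U' (\<lambda>x. g' (f' x))" for k
    by (rule Ck_on_compose[OF \<open>open U'\<close> _ _ W(3)])
      (auto simp: U'_def intro: Ck_on_subset[OF U(3)])
  moreover have "g' (f' y) = (g \<circ> f) y" if "y \<in> A \<inter> U'" for y
    using that U(4)[of y] W(4)[of "f y"] assms(3) by (auto simp: U'_def)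
  ultimately show "\<exists>U h. open U \<and> x \<in> U \<and> (\<forall>k. Ck_on k U h) \<and> (\<forall>y\<in>A \<inter> U. h y = (g \<circ> f) y)"
    by blast
qed

section \<open>Lines and their projectors\<close>

lemma span_singleton_in_proj_space:
  assumes "v \<noteq> 0"
  shows "vec.span {v} \<in> (proj_space :: (complex ^ 'n) set set)"
  using assms by (simp add: proj_space_def vec.dim_singleton)

lemma proj_space_cases:
  assumes "L \<in> (proj_space :: (complex ^ 'n) set set)"
  obtains v where "v \<noteq> 0" "L = vec.span {v}"
proof -
  have L: "vec.subspace L" "vec.dim L = 1"
    using assms by (auto simp: proj_space_def)
  obtain B where B: "B \<subseteq> L" "vec.independent B" "L \<subseteq> vec.span B" "card B = vec.dim L"
    using vec.basis_exists[of L] .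
  then obtain v where "B = {v}"
    using L(2) by (auto simp: card_1_singleton_iff)
  moreover have "v \<noteq> 0"
    using B(2) \<open>B = {v}\<close> by simp
  moreover have "L = vec.span B"
    using B(1,3) vec.span_minimal[OF B(1) L(1)] by blast
  ultimately show thesis
    using that by blast
qed

lemma topspace_proj_topology: "topspace proj_topology = (proj_space :: (complex ^ 'n) set set)"
proof -
  have "{v :: complex ^ 'n. v \<noteq> 0 \<and> vec.span {v} \<in> proj_space} = - {0}"
    using span_singleton_in_proj_space by auto
  then have "openin proj_topology (proj_space :: (complex ^ 'n) set set)"
    by (simp add: openin_proj_topology open_Compl)
  then show ?thesis
    by (auto simp: topspace_def openin_proj_topology)
qed

section \<open>Affine charts of projective space\<close>

lemma mem_affine_dom:
  assumes "v \<noteq> 0"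
  shows "vec.span {v} \<in> affine_dom j \<longleftrightarrow> v $ j \<noteq> 0"
proof -
  have "v \<in> vec.span {v}"
    by (simp add: vec.span_base)
  then show ?thesis
    using span_singleton_in_proj_space[OF assms] by (auto simp: affine_dom_def vec.span_singleton)
qed

lemma affine_coord_span:
  assumes "v $ j \<noteq> 0"
  shows "affine_coord j (vec.span {v}) = (\<chi> i. if i = j then 0 else v $ i / v $ j)"
  unfolding affine_coord_def
proof (rule the_equality)
  show "\<exists>z\<in>vec.span {v}. z $ j \<noteq> 0 \<and> (\<chi> i. if i = j then 0 else v $ i / v $ j) =
      (\<chi> i. if i = j then 0 else z $ i / z $ j)"
    using assms by (intro bexI[of _ v]) (simp_all add: vec.span_base)
  show "w = (\<chi> i. if i = j then 0 else v $ i / v $ j)"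
    if "\<exists>z\<in>vec.span {v}. z $ j \<noteq> 0 \<and> w = (\<chi> i. if i = j then 0 else z $ i / z $ j)" for w
    using that by (auto simp: vec.span_singleton vec_eq_iff)
qed

text \<open>The entry \<open>w $ j\<close> is overwritten, so this is a real affine map on the whole
  ambient space and supplies the smooth extension that \<open>smooth_on\<close> requires.\<close>

definition affine_point :: "'n \<Rightarrow> complex ^ 'n \<Rightarrow> complex ^ 'n" where
  "affine_point j w = (\<chi> i. if i = j then 1 else w $ i)"

lemma affine_point_nth [simp]: "affine_point j w $ i = (if i = j then 1 else w $ i)"
  by (simp add: affine_point_def)

lemma affine_point_nonzero: "affine_point j w \<noteq> 0"
  by (metis affine_point_nth zero_index zero_neq_one)

definition affine_line :: "'n \<Rightarrow> complex ^ 'n \<Rightarrow> (complex ^ 'n) set" where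
  "affine_line j w = vec.span {affine_point j w}"

lemma affine_line_in_affine_dom: "affine_line j w \<in> affine_dom j"
  by (simp add: affine_line_def mem_affine_dom affine_point_nonzero)

lemma affine_line_in_proj_space: "affine_line j w \<in> proj_space"
  by (simp add: affine_line_def span_singleton_in_proj_space affine_point_nonzero)

lemma affine_coord_affine_line:
  assumes "w $ j = 0"
  shows "affine_coord j (affine_line j w) = w"
  using assms by (simp add: affine_line_def affine_coord_span vec_eq_iff)

lemma affine_domE:
  assumes "L \<in> affine_dom j"
  obtains w where "w $ j = 0" "L = affine_line j w" "affine_coord j L = w"
proof -
  obtain v where v: "v \<noteq> 0" "L = vec.span {v}"
    using assms by (auto simp: affine_dom_def elim: proj_space_cases)
  then have vj: "v $ j \<noteq> 0"
    using assms mem_affine_dom by blast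
  define w where "w = (\<chi> i. if i = j then 0 else v $ i / v $ j)"
  have "v = v $ j *s affine_point j w"
    using vj by (simp add: vec_eq_iff w_def)
  then have "L = vec.span {v $ j *s affine_point j w}"
    using v by simp
  also have "\<dots> = vec.span {affine_point j w}"
    using vj by (simp add: vec.span_image_scale[of "{affine_point j w}" "\<lambda>_. v $ j", simplified])
  finally have "L = affine_line j w"
    by (simp add: affine_line_def)
  moreover have "w $ j = 0"
    by (simp add: w_def)
  ultimately show thesis
    using that affine_coord_affine_line by blast
qed

lemma inj_on_affine_coord: "inj_on (affine_coord j) (affine_dom (j :: 'n::finite))"
proof (rule inj_onI)
  fix L L' :: "(complex ^ 'n) set"
  assume "L \<in> affine_dom j" "L' \<in> affine_dom j" and eq: "affine_coord j L = affine_coord j L'"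
  then obtain w w' where "L = affine_line j w" "affine_coord j L = w"
      "L' = affine_line j w'" "affine_coord j L' = w'"
    by (auto elim!: affine_domE)
  with eq show "L = L'"
    by simp
qed

lemma affine_coord_image: "affine_coord (j :: 'n::finite) ` affine_dom j = {w :: complex ^ 'n. w $ j = 0}"
proof (intro set_eqI iffI)
  fix w :: "complex ^ 'n" assume "w \<in> {w. w $ j = 0}"
  then show "w \<in> affine_coord j ` affine_dom j"
    by (intro image_eqI[OF _ affine_line_in_affine_dom[of j w]]) (simp add: affine_coord_affine_line)
qed (auto elim: affine_domE)

lemma inv_into_affine_coord:
  assumes "w $ j = 0"
  shows "inv_into (affine_dom j) (affine_coord j) w = affine_line j w"
  using inv_into_f_f[OF inj_on_affine_coord affine_line_in_affine_dom] affine_coord_affine_line[OF assms]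
  by metis

section \<open>Rank-one projectors and Hermitian matrices\<close>

lemma ketbra_nth [simp]: "ketbra \<psi> $ a $ b = \<psi> $ a * cnj (\<psi> $ b)"
  by (simp add: ketbra_def)

lemma ketbra_scale: "ketbra (c *s \<psi>) = (cmod c)\<^sup>2 *\<^sub>R ketbra \<psi>"
  by (simp add: vec_eq_iff scaleR_conv_of_real[where 'a=complex] complex_norm_square[symmetric] mult_ac
      del: of_real_power)

lemma norm_vec_scale_complex: "norm (c *s (\<psi> :: complex ^ 'n)) = cmod c * norm \<psi>"
  by (simp add: norm_vec_def L2_set_def norm_mult power_mult_distrib flip: sum_distrib_left)
    (simp add: real_sqrt_mult)

text \<open>Unit vectors of a line differ by a phase, which cancels in \<open>ketbra\<close>; this
  makes the definite description well defined. A multiple \<open>c *s v\<close> enters only through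
  the square of \<open>cmod c\<close>, and norm one fixes that value.\<close>

lemma line_projector_span:
  fixes v :: "complex ^ 'n"
  assumes "v \<noteq> 0"
  shows "line_projector (vec.span {v}) = inverse (v \<bullet> v) *\<^sub>R ketbra v"
  unfolding line_projector_def
proof (rule the_equality)
  have *: "(cmod c)\<^sup>2 = inverse (v \<bullet> v)" if "norm (c *s v) = 1" for c
    using that assms by (simp add: norm_vec_scale_complex dot_square_norm field_simps flip: power_mult_distrib)
  have "norm (of_real (inverse (norm v)) *s v) = 1"
    using assms by (simp add: norm_vec_scale_complex norm_inverse)
  moreover from *[OF this] have "ketbra (of_real (inverse (norm v)) *s v) = inverse (v \<bullet> v) *\<^sub>R ketbra v"
    by (simp only: ketbra_scale)
  moreover have "of_real (inverse (norm v)) *s v \<in> vec.span {v}"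
    unfolding vec.span_singleton by blast
  ultimately show "\<exists>\<psi>\<in>vec.span {v}. norm \<psi> = 1 \<and> inverse (v \<bullet> v) *\<^sub>R ketbra v = ketbra \<psi>"
    by metis
  show "\<rho> = inverse (v \<bullet> v) *\<^sub>R ketbra v" if "\<exists>\<psi>\<in>vec.span {v}. norm \<psi> = 1 \<and> \<rho> = ketbra \<psi>" for \<rho>
    using that * unfolding vec.span_singleton by (auto simp: ketbra_scale)
qed

definition hermitian :: "complex ^ 'n ^ 'n \<Rightarrow> bool" where
  "hermitian A \<longleftrightarrow> (\<forall>a b. cnj (A $ b $ a) = A $ a $ b)"

lemma trace_ketbra: "trace (ketbra v) = of_real (v \<bullet> v)"
  by (simp add: trace_def inner_vec_def inner_complex_def complex_eq_iff power2_eq_square)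

lemma hermitian_ketbra: "hermitian (ketbra v)"
  by (simp add: hermitian_def)

lemma hermitian_scaleR: "hermitian A \<Longrightarrow> hermitian (r *\<^sub>R A)"
  by (simp add: hermitian_def)

lemma hermitian_add: "hermitian A \<Longrightarrow> hermitian B \<Longrightarrow> hermitian (A + B)"
  by (simp add: hermitian_def)

lemma hermitian_sum: "(\<And>i. i \<in> I \<Longrightarrow> hermitian (A i)) \<Longrightarrow> hermitian (\<Sum>i\<in>I. A i)"
  by (simp add: hermitian_def)

lemma hermitian_mat_1: "hermitian (mat 1)"
  unfolding hermitian_def mat_def by auto

text \<open>
  The rank-one condition is expressed by the vanishing of the \<open>2 \<times> 2\<close> minors; a column through
  a nonzero diagonal entry then spans the line.
\<close>

lemma hermitian_minors_imp_ketbra: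
  fixes A :: "complex ^ 'n ^ 'n"
  assumes "hermitian A" "trace A = 1"
    and minors: "\<And>a b c d. A $ a $ b * A $ c $ d = A $ a $ d * A $ c $ b"
  obtains \<psi> where "\<psi> \<noteq> 0" "A = inverse (\<psi> \<bullet> \<psi>) *\<^sub>R ketbra \<psi>"
proof -
  have "\<exists>c. A $ c $ c \<noteq> 0"
  proof (rule ccontr)
    assume "\<not> ?thesis"
    then have "trace A = 0"
      by (simp add: trace_def)
    with assms(2) show False
      by simp
  qed
  then obtain c where c: "A $ c $ c \<noteq> 0" ..
  define \<psi> where "\<psi> = column c A"
  have herm: "cnj (A $ b $ a) = A $ a $ b" for a b
    using assms(1) by (simp add: hermitian_def)
  define r where "r = Re (A $ c $ c)"
  have "A $ c $ c = of_real r"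
    using herm[of c c] by (simp add: r_def complex_eq_iff)
  \<comment> \<open>With Hermitian symmetry, the (a, b) entry of \<open>ketbra \<psi>\<close> is
    A_ac A_cb, and the minor through the diagonal position c turns it into A_cc A_ab.\<close>
  then have r: "r \<noteq> 0" and ket: "ketbra \<psi> = r *\<^sub>R A"
    using c minors[of _ c c]
    by (simp_all add: vec_eq_iff \<psi>_def column_def herm mult.commute scaleR_conv_of_real[where 'a = complex])
  have "of_real (\<psi> \<bullet> \<psi>) = trace (r *\<^sub>R A)"
    unfolding ket[symmetric] trace_ketbra ..
  also have "\<dots> = of_real r"
    using assms(2) by (simp add: trace_def scaleR_conv_of_real[where 'a = complex] flip: sum_distrib_left)
  finally have "\<psi> \<bullet> \<psi> = r"
    by simp
  with ket r show thesis
    by (intro that[of \<psi>]) auto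
qed

section \<open>The generalized Gell-Mann matrices\<close>

lemma matrix_unit_axis: "matrix_unit j k = axis j (axis k 1)"
  by (simp add: matrix_unit_def axis_def vec_eq_iff)

text \<open>The real inner product of matrices is the real part of the trace of A times the adjoint
  of B, which on Hermitian matrices is the trace form. The trace relations between Gell-Mann
  matrices thus become orthogonality relations.\<close>

lemma inner_matrix_unit: "A \<bullet> matrix_unit j k = Re (A $ j $ k)"
  by (simp add: matrix_unit_axis inner_axis inner_complex_def)

lemma inner_gell_mann_sym: "A \<bullet> gell_mann_sym j k = Re (A $ j $ k) + Re (A $ k $ j)"
  by (simp add: gell_mann_sym_def inner_add_right inner_matrix_unit)

lemma inner_gell_mann_asym: "A \<bullet> gell_mann_asym j k = Im (A $ k $ j) - Im (A $ j $ k)"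
proof -
  have "gell_mann_asym j k = axis k (axis j \<i>) - axis j (axis k \<i>)"
    by (auto simp: gell_mann_asym_def matrix_unit_def axis_def vec_eq_iff)
  then show ?thesis
    by (simp add: inner_diff_right inner_axis inner_complex_def)
qed

text \<open>A diagonal of l ones followed by -l has squared norm l + l^2 = l(l+1); this factor
  rescales it to 2.\<close>

definition gell_mann_scale :: "'n::{finite, linorder} \<Rightarrow> real" where
  "gell_mann_scale k = sqrt (2 / (real (card {..<k}) * (real (card {..<k}) + 1)))"

lemma inner_gell_mann_diag:
  "A \<bullet> gell_mann_diag k =
     gell_mann_scale k * ((\<Sum>j<k. Re (A $ j $ j)) - real (card {..<k}) * Re (A $ k $ k))"
  by (simp add: gell_mann_diag_def gell_mann_scale_def Let_def inner_diff_right inner_sum_right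
      inner_matrix_unit)

lemma gell_mann_sym_nth:
  "gell_mann_sym j k $ a $ b = (if a = j \<and> b = k then 1 else 0) + (if a = k \<and> b = j then 1 else 0)"
  by (simp add: gell_mann_sym_def matrix_unit_def)

lemma gell_mann_asym_nth:
  "gell_mann_asym j k $ a $ b = (if a = k \<and> b = j then \<i> else 0) - (if a = j \<and> b = k then \<i> else 0)"
proof -
  have "- \<i> * (if P then 1 else 0) + \<i> * (if Q then 1 else 0) =
      (if Q then \<i> else 0) - (if P then \<i> else 0)" for P Q
    by simp
  then show ?thesis
    by (simp only: gell_mann_asym_def matrix_unit_def vec_lambda_beta)
qed

lemma gell_mann_diag_nth:
  "gell_mann_diag k $ a $ b =
     (if a = b then of_real (gell_mann_scale k * (if a < k then 1 else if a = k then - real (card {..<k}) else 0))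
      else 0)"
proof -
  have "(\<Sum>j<k. if a = j \<and> b = j then (1::complex) else 0) = (if a = b \<and> a < k then 1 else 0)"
    by (cases "a = b") (auto simp: lessThan_def intro!: sum.neutral)
  then show ?thesis
    by (auto simp: gell_mann_diag_def gell_mann_scale_def Let_def matrix_unit_def scaleR_conv_of_real[where 'a = complex])
qed

lemma gell_mann_scale_pos:
  assumes "(j :: 'n::{finite, linorder}) < k"
  shows "gell_mann_scale k > 0" "card {..<k} > 0"
proof -
  show "card {..<k} > 0"
    using assms by (auto simp: card_gt_0_iff)
  then show "gell_mann_scale k > 0"
    by (simp add: gell_mann_scale_def)
qed

lemma gell_mann_matricesI:
  assumes "j < k"
  shows "gell_mann_sym j k \<in> gell_mann_matrices" "gell_mann_asym j k \<in> gell_mann_matrices"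
    "gell_mann_diag k \<in> gell_mann_matrices"
  using assms unfolding gell_mann_matrices_def by blast+

lemma gell_mann_cases:
  assumes "A \<in> gell_mann_matrices"
  obtains (sym) j k where "j < k" "A = gell_mann_sym j k"
    | (asym) j k where "j < k" "A = gell_mann_asym j k"
    | (diag) j k where "j < k" "A = gell_mann_diag k"
  using assms that unfolding gell_mann_matrices_def Un_iff mem_Collect_eq
  by (elim disjE exE conjE) (rule that, assumption, assumption)+

lemma hermitian_gell_mann_sym: "hermitian (gell_mann_sym j k)"
proof -
  have "cnj ((if P then 1 else 0) + (if Q then 1 else 0)) = (if Q then 1 else 0) + (if P then 1 else 0)" for P Q
    by simp
  then show ?thesis
    by (simp only: hermitian_def gell_mann_sym_nth conj_commute simp_thms)
qed

lemma hermitian_gell_mann_asym: "hermitian (gell_mann_asym j k)"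
proof -
  have "cnj ((if P then \<i> else 0) - (if Q then \<i> else 0)) = (if Q then \<i> else 0) - (if P then \<i> else 0)" for P Q
    by simp
  then show ?thesis
    by (simp only: hermitian_def gell_mann_asym_nth conj_commute simp_thms)
qed

lemma hermitian_gell_mann_diag: "hermitian (gell_mann_diag k)"
  unfolding hermitian_def gell_mann_diag_nth by auto

lemma hermitian_gell_mann: "A \<in> gell_mann_matrices \<Longrightarrow> hermitian A"
  by (cases A rule: gell_mann_cases)
    (simp_all add: hermitian_gell_mann_sym hermitian_gell_mann_asym hermitian_gell_mann_diag)

lemma mat_1_inner_gell_mann: "A \<in> gell_mann_matrices \<Longrightarrow> mat 1 \<bullet> A = 0"
  by (cases A rule: gell_mann_cases)
    (auto simp: inner_gell_mann_sym inner_gell_mann_asym inner_gell_mann_diag mat_def)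

text \<open>The two orderings exclude the swapped match \<open>j' = k \<and> k' = j\<close>, so only
  one of the two matrix units can contribute.\<close>

lemma gell_mann_sym_nth_less:
  fixes j k :: "'n::{finite, linorder}"
  assumes "j < k" "j' < k'"
  shows "gell_mann_sym j k $ j' $ k' = (if j' = j \<and> k' = k then 1 else 0)"
    and "gell_mann_sym j k $ k' $ j' = (if j' = j \<and> k' = k then 1 else 0)"
proof -
  have "\<not> (j' = k \<and> k' = j)"
    using assms by auto
  then show "gell_mann_sym j k $ j' $ k' = (if j' = j \<and> k' = k then 1 else 0)"
    "gell_mann_sym j k $ k' $ j' = (if j' = j \<and> k' = k then 1 else 0)"
    by (simp_all only: gell_mann_sym_nth conj_commute if_False add_0_right add_0_left)
qed

lemma gell_mann_asym_nth_less:
  fixes j k :: "'n::{finite, linorder}"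
  assumes "j < k" "j' < k'"
  shows "gell_mann_asym j k $ j' $ k' = (if j' = j \<and> k' = k then - \<i> else 0)"
    and "gell_mann_asym j k $ k' $ j' = (if j' = j \<and> k' = k then \<i> else 0)"
proof -
  have "\<not> (j' = k \<and> k' = j)"
    using assms by auto
  moreover have "0 - (if P then \<i> else 0) = (if P then - \<i> else 0)" for P
    by simp
  ultimately show "gell_mann_asym j k $ j' $ k' = (if j' = j \<and> k' = k then - \<i> else 0)"
    "gell_mann_asym j k $ k' $ j' = (if j' = j \<and> k' = k then \<i> else 0)"
    by (simp_all only: gell_mann_asym_nth conj_commute if_False diff_0_right)
qed

lemma gell_mann_sym_nth_diag: "(j :: 'n::{finite, linorder}) < k \<Longrightarrow> gell_mann_sym j k $ a $ a = 0"
  by (auto simp: gell_mann_sym_nth)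

lemma gell_mann_asym_nth_diag: "(j :: 'n::{finite, linorder}) < k \<Longrightarrow> gell_mann_asym j k $ a $ a = 0"
  by (auto simp: gell_mann_asym_nth)

lemma gell_mann_inner_self:
  assumes "A \<in> gell_mann_matrices"
  shows "A \<bullet> A = 2"
  using assms
proof (cases A rule: gell_mann_cases)
  case (diag j k)
  define l where "l = real (card {..<k})"
  have "l > 0"
    using gell_mann_scale_pos[OF diag(1)] by (simp add: l_def)
  have "A \<bullet> A = (gell_mann_scale k)\<^sup>2 * (l * (l + 1))"
    by (simp add: diag(2) inner_gell_mann_diag gell_mann_diag_nth algebra_simps power2_eq_square flip: l_def)
  also have "(gell_mann_scale k)\<^sup>2 = 2 / (l * (l + 1))"
    using \<open>l > 0\<close> by (simp add: gell_mann_scale_def l_def)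
  finally show ?thesis
    using \<open>l > 0\<close> by simp
qed (simp_all add: inner_gell_mann_sym inner_gell_mann_asym gell_mann_sym_nth_less gell_mann_asym_nth_less)

text \<open>The matrix for \<open>k'\<close> is scalar on the indices below \<open>k'\<close>, and
  these contain the whole support of the matrix for \<open>k\<close>. The inner product is thus a
  multiple of the trace of the latter, which is zero.\<close>

lemma gell_mann_diag_orthogonal:
  fixes k k' :: "'n::{finite, linorder}"
  assumes "k < k'"
  shows "gell_mann_diag k \<bullet> gell_mann_diag k' = 0"
proof -
  have "{..<k'} = {..<k} \<union> {k} \<union> {k<..<k'}"
    using assms by auto
  then have "(\<Sum>j<k'. Re (gell_mann_diag k $ j $ j)) =
      (\<Sum>j<k. Re (gell_mann_diag k $ j $ j)) + Re (gell_mann_diag k $ k $ k)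
      + (\<Sum>j\<in>{k<..<k'}. Re (gell_mann_diag k $ j $ j))"
    by (simp only:) (subst sum.union_disjoint; force)+
  also have "(\<Sum>j\<in>{k<..<k'}. Re (gell_mann_diag k $ j $ j)) = 0"
    by (rule sum.neutral) (auto simp: gell_mann_diag_nth)
  also have "(\<Sum>j<k. Re (gell_mann_diag k $ j $ j)) + Re (gell_mann_diag k $ k $ k) + 0 = 0"
    by (simp add: gell_mann_diag_nth)
  finally have "(\<Sum>j<k'. Re (gell_mann_diag k $ j $ j)) = 0" .
  moreover have "gell_mann_diag k $ k' $ k' = 0"
    using assms by (auto simp: gell_mann_diag_nth)
  ultimately show ?thesis
    by (simp add: inner_gell_mann_diag)
qed

text \<open>Matrices of different kinds are separated by diagonal against off-diagonal support or by
  real against imaginary entries. Distinct off-diagonal matrices of the same kind have disjoint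
  supports.\<close>

lemma gell_mann_orthogonal:
  assumes "A \<in> gell_mann_matrices" "B \<in> gell_mann_matrices" "A \<noteq> B"
  shows "A \<bullet> B = 0"
  using assms(1)
proof (cases A rule: gell_mann_cases)
  case A: (sym j k)
  from assms(2) show ?thesis
    by (cases B rule: gell_mann_cases)
      (use A assms(3) in \<open>auto simp: inner_gell_mann_sym inner_gell_mann_asym inner_gell_mann_diag
        gell_mann_sym_nth_less gell_mann_sym_nth_diag\<close>)
next
  case A: (asym j k)
  from assms(2) show ?thesis
    by (cases B rule: gell_mann_cases)
      (use A assms(3) in \<open>auto simp: inner_gell_mann_sym inner_gell_mann_asym inner_gell_mann_diag
        gell_mann_asym_nth_less gell_mann_asym_nth_diag\<close>)
next
  case A: (diag j k)
  from assms(2) show ?thesis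
  proof (cases B rule: gell_mann_cases)
    case (diag j' k')
    then have "k \<noteq> k'"
      using A assms(3) by auto
    then show ?thesis
      using gell_mann_diag_orthogonal[of k k'] gell_mann_diag_orthogonal[of k' k]
      by (cases k k' rule: linorder_cases) (simp_all add: A diag inner_commute)
  qed (use A in \<open>auto simp: inner_gell_mann_sym inner_gell_mann_asym gell_mann_diag_nth\<close>)
qed

lemma inner_mat_1: "A \<bullet> mat 1 = Re (trace A)"
  by (simp add: inner_vec_def mat_def trace_def inner_complex_def if_distrib if_distribR cong: if_cong)

lemma trace_hermitian:
  assumes "hermitian A"
  shows "trace A = of_real (A \<bullet> mat 1)"
proof -
  have "Im (A $ a $ a) = 0" for a
    using assms[unfolded hermitian_def, THEN spec, THEN spec, of a a] by (simp add: complex_eq_iff)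
  then show ?thesis
    by (simp add: inner_mat_1 complex_eq_iff) (simp add: trace_def)
qed

text \<open>
  Orthogonality to the diagonal matrices says that each diagonal entry is the mean of its
  predecessors, so that all of them agree with the first one.
\<close>

lemma orthogonal_gell_mann_imp_zero:
  fixes A :: "complex ^ 'n::{finite, linorder} ^ 'n::{finite, linorder}"
  assumes herm: "hermitian A" and tr: "A \<bullet> mat 1 = 0"
    and orth: "\<And>B. B \<in> gell_mann_matrices \<Longrightarrow> A \<bullet> B = 0"
  shows "A = 0"
proof -
  have A: "cnj (A $ b $ a) = A $ a $ b" for a b
    using herm by (simp add: hermitian_def)
  have re: "Re (A $ b $ a) = Re (A $ a $ b)" and im: "Im (A $ b $ a) = - Im (A $ a $ b)" for a b
    using A[of b a] by (simp_all add: complex_eq_iff)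
  have off: "A $ j $ k = 0" if "j < k" for j k
  proof -
    have "A \<bullet> gell_mann_sym j k = 0" "A \<bullet> gell_mann_asym j k = 0"
      by (intro orth gell_mann_matricesI that)+
    then show ?thesis
      using re[of k j] im[of k j] by (simp add: inner_gell_mann_sym inner_gell_mann_asym complex_eq_iff)
  qed
  define m :: 'n where "m = Min UNIV"
  have m: "m \<le> k" for k
    by (simp add: m_def)
  have diag: "Re (A $ k $ k) = Re (A $ m $ m)" for k
  \<comment> \<open>The index type is an abstract finite linear order, so the number of predecessors
    serves as the induction measure.\<close>
  proof (induction "card {..<k}" arbitrary: k rule: less_induct)
    case less
    show ?case
    proof (cases "k = m")
      case False
      then have "m < k"
        using m[of k] by simp
      then have "A \<bullet> gell_mann_diag k = 0"
        by (intro orth gell_mann_matricesI)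
      moreover have "Re (A $ j $ j) = Re (A $ m $ m)" if "j < k" for j
      proof (rule less)
        have "{..<j} \<subset> {..<k}"
          using that by auto
        then show "card {..<j} < card {..<k}"
          by (simp add: psubset_card_mono)
      qed
      ultimately have "real (card {..<k}) * Re (A $ m $ m) = real (card {..<k}) * Re (A $ k $ k)"
        using gell_mann_scale_pos[OF \<open>m < k\<close>] by (simp add: inner_gell_mann_diag)
      then show ?thesis
        using gell_mann_scale_pos(2)[OF \<open>m < k\<close>] by auto
    qed simp
  qed
  \<comment> \<open>The vanishing trace is N times the common diagonal value, so that value is
    zero.\<close>
  have "(\<Sum>k\<in>UNIV. Re (A $ k $ k)) = 0"
    using tr by (simp add: inner_mat_1 trace_def)
  moreover have "(\<Sum>k\<in>UNIV. Re (A $ k $ k)) = (\<Sum>k\<in>(UNIV :: 'n set). Re (A $ m $ m))"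
    by (rule sum.cong[OF refl diag])
  ultimately have "Re (A $ m $ m) = 0"
    by simp
  show ?thesis
  proof (simp add: vec_eq_iff, intro allI)
    fix a b
    show "A $ a $ b = 0"
    proof (cases a b rule: linorder_cases)
      case greater
      then show ?thesis
        using off[of b a] A[of b a] by simp
    next
      case equal
      then show ?thesis
        using diag[of b] \<open>Re (A $ m $ m) = 0\<close> im[of b b] by (simp add: complex_eq_iff)
    qed (simp add: off)
  qed
qed

section \<open>Coordinates of density matrices\<close>

text \<open>This is unchanged when \<open>v\<close> is rescaled and is rational in the real
  coordinates of \<open>v\<close>, hence smooth away from zero without choosing unit
  representatives.\<close>

definition projector :: "complex ^ 'n \<Rightarrow> complex ^ 'n ^ 'n" where
  "projector v = inverse (v \<bullet> v) *\<^sub>R ketbra v"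

lemma projector_nth: "projector v $ a $ b = of_real (inverse (v \<bullet> v)) * (v $ a * cnj (v $ b))"
  by (simp add: projector_def scaleR_conv_of_real[where 'a = complex])

lemma hermitian_projector: "hermitian (projector v)"
  by (simp add: projector_def hermitian_scaleR hermitian_ketbra)

lemma projector_inner_mat_1: "v \<noteq> 0 \<Longrightarrow> projector v \<bullet> mat 1 = 1"
  by (simp only: projector_def inner_scaleR_left) (simp add: inner_mat_1 trace_ketbra)

lemma mat_1_inner_mat_1: "(mat 1 :: complex ^ 'n ^ 'n) \<bullet> mat 1 = real CARD('n)"
  by (simp add: inner_mat_1 trace_I)

text \<open>The fixed order of the Gell-Mann matrices is modelled by an arbitrary enumeration, so no
  ordering convention enters the result.\<close>

locale gell_mann_numbering =
  fixes lam :: "nat \<Rightarrow> complex ^ 'n::{card2, linorder} ^ 'n::{card2, linorder}"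
  assumes bij_lam: "bij_betw lam {1..CARD('n)\<^sup>2 - 1} gell_mann_matrices"
begin

definition bloch_scale :: real where
  "bloch_scale = sqrt ((real CARD('n) - 1) / (2 * real CARD('n)))"

lemma bloch_scale_pos: "bloch_scale > 0"
  using two_le_card[where 'a = 'n] by (simp add: bloch_scale_def)

text \<open>With s = \<open>bloch_scale\<close>, pairing I/N + s sum x_i lam_i with lam_i gives 2 s
  x_i, since the lam_i are traceless, orthogonal and of squared norm 2. This explains the factor,
  and it extends the density map to an affine map on all matrices.\<close>

definition encode :: "_ \<Rightarrow> 'n trunc_poly" where
  "encode \<rho> = of_real (1 / real CARD('n)) +
     (\<Sum>i = 1..CARD('n)\<^sup>2 - 1. (inverse (2 * bloch_scale) * (\<rho> \<bullet> lam i)) *\<^sub>R eps ^ (i - 1))"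

text \<open>The subtraction undoes the shift of the constant coefficient by 1/N, after which the
  coefficient of \<open>eps ^ (i - 1)\<close> is the i-th Bloch coordinate.\<close>

definition decode :: "'n trunc_poly \<Rightarrow> _" where
  "decode q = (1 / real CARD('n)) *\<^sub>R mat 1 +
     bloch_scale *\<^sub>R (\<Sum>i = 1..CARD('n)\<^sup>2 - 1. ((q - of_real (1 / real CARD('n))) \<bullet> eps ^ (i - 1)) *\<^sub>R lam i)"

lemma lam_in: "i \<in> {1..CARD('n)\<^sup>2 - 1} \<Longrightarrow> lam i \<in> gell_mann_matrices"
  using bij_lam by (rule bij_betwE[THEN bspec])

lemma lam_inner:
  assumes "i \<in> {1..CARD('n)\<^sup>2 - 1}" "j \<in> {1..CARD('n)\<^sup>2 - 1}"
  shows "lam i \<bullet> lam j = (if i = j then 2 else 0)"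
proof (cases "i = j")
  case False
  then have "lam i \<noteq> lam j"
    using inj_onD[OF bij_betw_imp_inj_on[OF bij_lam] _ assms] by blast
  then show ?thesis
    using False gell_mann_orthogonal[OF lam_in[OF assms(1)] lam_in[OF assms(2)]] by simp
qed (simp add: gell_mann_inner_self[OF lam_in[OF assms(2)]])

lemma sum_lam_inner:
  assumes "i \<in> {1..CARD('n)\<^sup>2 - 1}"
  shows "(\<Sum>j = 1..CARD('n)\<^sup>2 - 1. x j *\<^sub>R lam j) \<bullet> lam i = 2 * x i"
proof -
  have "(\<Sum>j = 1..CARD('n)\<^sup>2 - 1. x j *\<^sub>R lam j) \<bullet> lam i =
      (\<Sum>j = 1..CARD('n)\<^sup>2 - 1. if j = i then 2 * x j else 0)"
    unfolding inner_sum_left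
    by (rule sum.cong[OF refl]) (use lam_inner[OF _ assms] in \<open>simp add: inner_scaleR_left\<close>)
  also have "\<dots> = 2 * x i"
    using assms by simp
  finally show ?thesis .
qed

lemma sum_lam_inner_mat_1: "(\<Sum>j = 1..CARD('n)\<^sup>2 - 1. x j *\<^sub>R lam j) \<bullet> mat 1 = 0"
  unfolding inner_sum_left
  by (rule sum.neutral) (use mat_1_inner_gell_mann[OF lam_in] in \<open>simp add: inner_commute\<close>)

lemma hermitian_sum_lam: "hermitian (\<Sum>j = 1..CARD('n)\<^sup>2 - 1. x j *\<^sub>R lam j)"
  by (intro hermitian_sum hermitian_scaleR hermitian_gell_mann lam_in)

text \<open>The difference of both sides is Hermitian, traceless and orthogonal to every Gell-Mann
  matrix, hence zero. Completeness of the family is thus obtained without counting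
  dimensions.\<close>

lemma gell_mann_expansion:
  assumes "hermitian A" "A \<bullet> mat 1 = 0"
  shows "A = (\<Sum>i = 1..CARD('n)\<^sup>2 - 1. (A \<bullet> lam i / 2) *\<^sub>R lam i)" (is "A = ?S")
proof -
  have "A + (- 1) *\<^sub>R ?S = 0"
  proof (rule orthogonal_gell_mann_imp_zero)
    show "hermitian (A + (- 1) *\<^sub>R ?S)"
      using assms(1) by (intro hermitian_add hermitian_scaleR hermitian_sum_lam)
    show "(A + (- 1) *\<^sub>R ?S) \<bullet> mat 1 = 0"
      unfolding inner_add_left inner_scaleR_left sum_lam_inner_mat_1 assms(2) by simp
    fix B :: "complex ^ 'n::{card2, linorder} ^ 'n::{card2, linorder}"
    assume "B \<in> gell_mann_matrices"
    then obtain i where i: "i \<in> {1..CARD('n)\<^sup>2 - 1}" "B = lam i"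
      using bij_betw_imp_surj_on[OF bij_lam] by blast
    show "(A + (- 1) *\<^sub>R ?S) \<bullet> B = 0"
      unfolding inner_add_left inner_scaleR_left i(2) sum_lam_inner[OF i(1)] by simp
  qed
  then show ?thesis
    by simp
qed

lemma density_expansion:
  assumes "hermitian \<rho>" "\<rho> \<bullet> mat 1 = 1"
  shows "\<rho> = (1 / real CARD('n)) *\<^sub>R mat 1 + bloch_scale *\<^sub>R
    (\<Sum>i = 1..CARD('n)\<^sup>2 - 1. (inverse (2 * bloch_scale) * (\<rho> \<bullet> lam i)) *\<^sub>R lam i)"
proof -
  define A where "A = \<rho> + (- 1 / real CARD('n)) *\<^sub>R mat 1"
  have "hermitian A"
    unfolding A_def by (intro hermitian_add hermitian_scaleR hermitian_mat_1 assms(1))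
  moreover have "A \<bullet> mat 1 = 0"
    unfolding A_def inner_add_left inner_scaleR_left mat_1_inner_mat_1 assms(2) by simp
  ultimately have "A = (\<Sum>i = 1..CARD('n)\<^sup>2 - 1. (A \<bullet> lam i / 2) *\<^sub>R lam i)"
    by (rule gell_mann_expansion)
  also have "\<dots> = bloch_scale *\<^sub>R
      (\<Sum>i = 1..CARD('n)\<^sup>2 - 1. (inverse (2 * bloch_scale) * (\<rho> \<bullet> lam i)) *\<^sub>R lam i)"
    unfolding scaleR_sum_right
  proof (rule sum.cong[OF refl])
    fix i assume "i \<in> {1..CARD('n)\<^sup>2 - 1}"
    then have "A \<bullet> lam i = \<rho> \<bullet> lam i"
      unfolding A_def inner_add_left inner_scaleR_left by (simp add: mat_1_inner_gell_mann[OF lam_in])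
    then show "(A \<bullet> lam i / 2) *\<^sub>R lam i =
        bloch_scale *\<^sub>R (inverse (2 * bloch_scale) * (\<rho> \<bullet> lam i)) *\<^sub>R lam i"
      using bloch_scale_pos by simp
  qed
  finally show ?thesis
    by (simp add: A_def algebra_simps)
qed

lemma sum_eps_inner:
  assumes "i \<in> {1..CARD('n)\<^sup>2 - 1}"
  shows "(\<Sum>j = 1..CARD('n)\<^sup>2 - 1. x j *\<^sub>R (eps :: 'n trunc_poly) ^ (j - 1)) \<bullet> eps ^ (i - 1) = x i"
proof -
  have "(\<Sum>j = 1..CARD('n)\<^sup>2 - 1. x j *\<^sub>R (eps :: 'n trunc_poly) ^ (j - 1)) \<bullet> eps ^ (i - 1) =
      (\<Sum>j = 1..CARD('n)\<^sup>2 - 1. if j = i then x j else 0)"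
    unfolding inner_sum_left
  proof (rule sum.cong[OF refl])
    fix j assume j: "j \<in> {1..CARD('n)\<^sup>2 - 1}"
    have "(eps :: 'n trunc_poly) ^ (j - 1) \<bullet> eps ^ (i - 1) = (if j - 1 = i - 1 then 1 else 0)"
      by (rule inner_eps_power_eps_power) (use j assms in auto)
    moreover have "j - 1 = i - 1 \<longleftrightarrow> j = i"
      using j assms by auto
    ultimately show "(x j *\<^sub>R (eps :: 'n trunc_poly) ^ (j - 1)) \<bullet> eps ^ (i - 1) = (if j = i then x j else 0)"
      by simp
  qed
  also have "\<dots> = x i"
    using assms by simp
  finally show ?thesis .
qed

lemma eps_expansion: "(q :: 'n trunc_poly) = (\<Sum>i = 1..CARD('n)\<^sup>2 - 1. (q \<bullet> eps ^ (i - 1)) *\<^sub>R eps ^ (i - 1))"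
  (is "q = ?S")
proof (rule euclidean_eqI)
  fix b :: "'n trunc_poly" assume "b \<in> Basis"
  then obtain k where k: "k < CARD('n)\<^sup>2 - 1" "b = eps ^ k"
    by (auto simp: Basis_trunc_poly_def)
  then show "q \<bullet> b = ?S \<bullet> b"
    using sum_eps_inner[of "Suc k" "\<lambda>i. q \<bullet> eps ^ (i - 1)"] by simp
qed

lemma decode_encode:
  assumes "hermitian \<rho>" "\<rho> \<bullet> mat 1 = 1"
  shows "decode (encode \<rho>) = \<rho>"
proof -
  have "decode (encode \<rho>) = (1 / real CARD('n)) *\<^sub>R mat 1 + bloch_scale *\<^sub>R
    (\<Sum>i = 1..CARD('n)\<^sup>2 - 1. (inverse (2 * bloch_scale) * (\<rho> \<bullet> lam i)) *\<^sub>R lam i)"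
    unfolding decode_def encode_def add_diff_cancel_left'
    by (intro arg_cong2[of _ _ _ _ "(+)"] arg_cong2[of _ _ _ _ scaleR] sum.cong refl) (rule sum_eps_inner)
  then show ?thesis
    using density_expansion[OF assms] by simp
qed

lemma decode_inner_lam:
  assumes "i \<in> {1..CARD('n)\<^sup>2 - 1}"
  shows "decode q \<bullet> lam i = 2 * bloch_scale * ((q - of_real (1 / real CARD('n))) \<bullet> eps ^ (i - 1))"
  unfolding decode_def inner_add_left inner_scaleR_left sum_lam_inner[OF assms]
  by (simp add: mat_1_inner_gell_mann[OF lam_in[OF assms]])

text \<open>Orthogonality of the \<open>lam i\<close> recovers every coefficient. Elements outside
  the image also decode to Hermitian matrices of trace one, just not to rank-one projectors.\<close>

lemma encode_decode: "encode (decode q) = q"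
proof -
  have "encode (decode q) = of_real (1 / real CARD('n)) +
      (\<Sum>i = 1..CARD('n)\<^sup>2 - 1. ((q - of_real (1 / real CARD('n))) \<bullet> eps ^ (i - 1)) *\<^sub>R eps ^ (i - 1))"
    unfolding encode_def using bloch_scale_pos
    by (intro arg_cong2[of _ _ _ _ "(+)"] arg_cong2[of _ _ _ _ scaleR] sum.cong refl)
      (simp add: decode_inner_lam)
  also have "\<dots> = q"
    unfolding eps_expansion[symmetric] by simp
  finally show ?thesis .
qed

lemma hermitian_decode: "hermitian (decode q)"
  unfolding decode_def by (intro hermitian_add hermitian_scaleR hermitian_sum_lam hermitian_mat_1)

lemma trace_decode: "trace (decode q) = 1"
proof -
  have "decode q \<bullet> mat 1 = 1"
    unfolding decode_def inner_add_left inner_scaleR_left mat_1_inner_mat_1 sum_lam_inner_mat_1 by simp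
  then show ?thesis
    by (simp add: trace_hermitian hermitian_decode)
qed

text \<open>Existence is the expansion above; uniqueness follows by pairing with each
  \<open>lam i\<close>. The value 0 outside the index range makes the coordinate function unique as
  a function on all of nat.\<close>

lemma bloch_coords_eq:
  assumes "hermitian \<rho>" "\<rho> \<bullet> mat 1 = 1"
  shows "bloch_coords lam \<rho> =
    (\<lambda>i. if i \<in> {1..CARD('n)\<^sup>2 - 1} then inverse (2 * bloch_scale) * (\<rho> \<bullet> lam i) else 0)" (is "_ = ?x")
  unfolding bloch_coords_def bloch_scale_def[symmetric]
proof (rule the_equality)
  have sum: "(\<Sum>i = 1..CARD('n)\<^sup>2 - 1. ?x i *\<^sub>R lam i) =
      (\<Sum>i = 1..CARD('n)\<^sup>2 - 1. (inverse (2 * bloch_scale) * (\<rho> \<bullet> lam i)) *\<^sub>R lam i)"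
    by (rule sum.cong) auto
  show "(\<forall>i. i \<notin> {1..CARD('n)\<^sup>2 - 1} \<longrightarrow> ?x i = 0) \<and>
      \<rho> = (1 / real CARD('n)) *\<^sub>R mat 1 + bloch_scale *\<^sub>R (\<Sum>i = 1..CARD('n)\<^sup>2 - 1. ?x i *\<^sub>R lam i)"
    unfolding sum by (intro conjI density_expansion[OF assms]) simp
next
  fix x :: "nat \<Rightarrow> real"
  assume x: "(\<forall>i. i \<notin> {1..CARD('n)\<^sup>2 - 1} \<longrightarrow> x i = 0) \<and>
      \<rho> = (1 / real CARD('n)) *\<^sub>R mat 1 + bloch_scale *\<^sub>R (\<Sum>i = 1..CARD('n)\<^sup>2 - 1. x i *\<^sub>R lam i)"
  show "x = ?x"
  proof
    fix i
    show "x i = ?x i"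
    proof (cases "i \<in> {1..CARD('n)\<^sup>2 - 1}")
      case True
      have "\<rho> \<bullet> lam i = ((1 / real CARD('n)) *\<^sub>R mat 1 +
          bloch_scale *\<^sub>R (\<Sum>i = 1..CARD('n)\<^sup>2 - 1. x i *\<^sub>R lam i)) \<bullet> lam i"
        by (intro arg_cong2[of _ _ _ _ inner] refl conjunct2[OF x])
      also have "\<dots> = 2 * bloch_scale * x i"
        unfolding inner_add_left inner_scaleR_left sum_lam_inner[OF True]
        by (simp add: mat_1_inner_gell_mann[OF lam_in[OF True]])
      finally have "\<rho> \<bullet> lam i = 2 * bloch_scale * x i" .
      then show ?thesis
        using True bloch_scale_pos by simp
    next
      case False
      then have "x i = 0"
        using conjunct1[OF x] by blast
      then show ?thesis
        by (simp only: if_not_P[OF False])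
    qed
  qed
qed

lemma density_map_span:
  assumes "v \<noteq> 0"
  shows "density_map lam (vec.span {v}) = encode (projector v)"
proof -
  let ?x = "\<lambda>i. inverse (2 * bloch_scale) * (projector v \<bullet> lam i)"
  have x: "bloch_coords lam (projector v) i = ?x i" if "i \<in> {1..CARD('n)\<^sup>2 - 1}" for i
    using that by (simp add: bloch_coords_eq[OF hermitian_projector projector_inner_mat_1[OF assms]])
  have one: "1 \<le> CARD('n)\<^sup>2 - 1"
    using trunc_dim_pos[where 'n = 'n] by simp
  have "density_map lam (vec.span {v}) =
      of_real (1 / real CARD('n) + ?x 1) + (\<Sum>i = 2..CARD('n)\<^sup>2 - 1. ?x i *\<^sub>R eps ^ (i - 1))"
    unfolding density_map_def Let_def line_projector_span[OF assms] projector_def[symmetric]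
    by (intro arg_cong2[of _ _ _ _ "(+)"] arg_cong2[of _ _ _ _ scaleR] arg_cong[of _ _ of_real] sum.cong refl x)
      (use one in auto)
  \<comment> \<open>The summand \<open>i = 1\<close> belongs to \<open>eps ^ 0 = 1\<close>; in the
    density map it is merged with the constant 1/N.\<close>
  also have "\<dots> = encode (projector v)"
    unfolding encode_def sum.atLeast_Suc_atMost[OF one]
    by (simp add: numeral_2_eq_2 scaleR_conv_of_real[of _ "1 :: 'n trunc_poly"] add.assoc)
  finally show ?thesis .
qed

lemma decode_density_map: "v \<noteq> 0 \<Longrightarrow> decode (density_map lam (vec.span {v})) = projector v"
  by (simp add: density_map_span decode_encode hermitian_projector projector_inner_mat_1)

text \<open>Decoded matrices are Hermitian of trace one by construction. Together with vanishing
  minors this forces a rank-one projector, so positivity requires no inequality.\<close>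

lemma density_image_iff_minors:
  "q \<in> density_map lam ` proj_space \<longleftrightarrow>
    (\<forall>a b c d. decode q $ a $ b * decode q $ c $ d = decode q $ a $ d * decode q $ c $ b)"
proof
  assume "q \<in> density_map lam ` proj_space"
  then obtain v where "v \<noteq> 0" "q = density_map lam (vec.span {v})"
    by (auto elim: proj_space_cases)
  then show "\<forall>a b c d. decode q $ a $ b * decode q $ c $ d = decode q $ a $ d * decode q $ c $ b"
    by (simp add: decode_density_map projector_nth mult_ac)
next
  assume "\<forall>a b c d. decode q $ a $ b * decode q $ c $ d = decode q $ a $ d * decode q $ c $ b"
  then obtain v where "v \<noteq> 0" "decode q = projector v"
    using hermitian_minors_imp_ketbra[OF hermitian_decode trace_decode] unfolding projector_def by metis
  then have "q = density_map lam (vec.span {v})"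
    using encode_decode[of q] by (simp add: density_map_span)
  with \<open>v \<noteq> 0\<close> show "q \<in> density_map lam ` proj_space"
    by (simp add: span_singleton_in_proj_space)
qed

end

section \<open>Charts of the image\<close>

text \<open>This is the linear projection onto the model space of the \<open>j\<close>-th affine
  chart, restricting to the identity there.\<close>

definition clear_coord :: "'n \<Rightarrow> complex ^ 'n \<Rightarrow> complex ^ 'n" where
  "clear_coord j w = (\<chi> i. if i = j then 0 else w $ i)"

lemma linear_clear_coord: "linear (clear_coord j)"
  by (rule linearI) (simp_all add: clear_coord_def vec_eq_iff)

lemma clear_coord_idem: "w $ j = 0 \<Longrightarrow> clear_coord j w = w"
  by (simp add: clear_coord_def vec_eq_iff)

lemma affine_point_eq: "affine_point j w = axis j 1 + clear_coord j w"
  by (simp add: clear_coord_def axis_def vec_eq_iff)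

lemma Ck_on_affine_point: "Ck_on k UNIV (affine_point j)"
  unfolding affine_point_eq[abs_def]
  by (intro Ck_on_add Ck_on_const Ck_on_bounded_linear linear_clear_coord[THEN linear_conv_bounded_linear[THEN iffD1]])
    simp_all

text \<open>This is the polarised form of \<open>ketbra\<close>. It is conjugate-linear in the
  second argument but bilinear over the reals, so the product rule applies.\<close>

definition outer :: "complex ^ 'n \<Rightarrow> complex ^ 'n \<Rightarrow> complex ^ 'n ^ 'n" where
  "outer u v = (\<chi> a b. u $ a * cnj (v $ b))"

lemma bounded_bilinear_outer: "bounded_bilinear outer"
  unfolding bilinear_conv_bounded_bilinear[symmetric] bilinear_def
  by (intro conjI allI linearI) (simp_all add: outer_def vec_eq_iff algebra_simps)

lemma Ck_on_projector:
  fixes f :: "'a::euclidean_space \<Rightarrow> complex ^ 'n"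
  assumes "open U" "\<And>x. x \<in> U \<Longrightarrow> f x \<noteq> 0" "Ck_on k U f"
  shows "Ck_on k U (\<lambda>x. projector (f x))"
proof -
  have "projector v = inverse (v \<bullet> v) *\<^sub>R outer v v" for v :: "complex ^ 'n"
    by (simp add: projector_def ketbra_def outer_def)
  moreover have "Ck_on k U (\<lambda>x. inverse (f x \<bullet> f x) *\<^sub>R outer (f x) (f x))"
    by (rule Ck_on_bilinear[OF bounded_bilinear_scaleR assms(1)
        Ck_on_inverse[OF assms(1) _ Ck_on_bilinear[OF bounded_bilinear_inner assms(1,3,3)]]
        Ck_on_bilinear[OF bounded_bilinear_outer assms(1,3,3)]]) (simp add: assms(2))
  ultimately show ?thesis
    by simp
qed

lemma subspace_coord_zero: "subspace {w :: complex ^ 'n. w $ j = 0}"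
  by (simp add: subspace_def)

text \<open>The real dimension counts the 2N standard basis vectors without \<open>axis j 1\<close>
  and \<open>axis j \<i>\<close>.\<close>

lemma dim_coord_zero: "dim {w :: complex ^ 'n. w $ j = 0} = 2 * CARD('n) - 2"
proof -
  define d :: "(complex ^ 'n) set" where "d = Basis - {axis j 1, axis j \<i>}"
  have "axis j 1 \<noteq> (axis j \<i> :: complex ^ 'n)"
    by (simp add: axis_eq_axis)
  then have "card {axis j 1, axis j \<i> :: complex ^ 'n} = 2"
    by simp
  moreover have B: "{axis j 1, axis j \<i> :: complex ^ 'n} \<subseteq> Basis"
    by (auto simp: axis_in_Basis_iff)
  ultimately have "card d = 2 * CARD('n) - 2"
    unfolding d_def by (subst card_Diff_subset) (auto simp: DIM_complex mult.commute)
  moreover have "{w :: complex ^ 'n. w $ j = 0} = {w. \<forall>i\<in>Basis. i \<notin> d \<longrightarrow> w \<bullet> i = 0}"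
  proof -
    have "(\<forall>i\<in>Basis. i \<notin> d \<longrightarrow> w \<bullet> i = 0) \<longleftrightarrow> w \<bullet> axis j 1 = 0 \<and> w \<bullet> axis j \<i> = 0" for w :: "complex ^ 'n"
      using B by (auto simp: d_def)
    then show ?thesis
      by (simp add: inner_axis inner_complex_def complex_eq_iff)
  qed
  moreover have "dim {w. \<forall>i\<in>Basis. i \<notin> d \<longrightarrow> w \<bullet> i = 0} = card d"
    by (rule dim_substandard) (auto simp: d_def)
  ultimately show ?thesis
    by simp
qed

lemma DIM_trunc_poly: "DIM('n::card2 trunc_poly) = CARD('n)\<^sup>2 - 1"
proof -
  have "inj_on (\<lambda>i. (eps :: 'n trunc_poly) ^ i) {..<CARD('n)\<^sup>2 - 1}"
  proof (rule inj_onI)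
    fix i j assume i: "i \<in> {..<CARD('n)\<^sup>2 - 1}" and j: "j \<in> {..<CARD('n)\<^sup>2 - 1}"
      and eq: "(eps :: 'n trunc_poly) ^ i = eps ^ j"
    then have "(if i = j then 1 else 0) = (1 :: real)"
      using inner_eps_power_eps_power[of i j, where 'n = 'n] inner_eps_power_eps_power[of j j, where 'n = 'n]
      unfolding eq lessThan_iff by (simp only: simp_thms if_True)
    then show "i = j"
      by (simp split: if_splits)
  qed
  then show ?thesis
    by (simp add: Basis_trunc_poly_def card_image del: One_nat_def)
qed

context gell_mann_numbering
begin

lemma Ck_on_encode:
  assumes "open U" "Ck_on k U f"
  shows "Ck_on k U (\<lambda>x. encode (f x))"
  unfolding encode_def
  by (intro Ck_on_add Ck_on_sum Ck_on_bilinear[OF bounded_bilinear_scaleR] Ck_on_const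
      Ck_on_bilinear[OF bounded_bilinear_mult] Ck_on_bilinear[OF bounded_bilinear_inner] assms)

lemma Ck_on_decode: "Ck_on k UNIV decode"
  unfolding decode_def[abs_def] diff_conv_add_uminus
  by (intro Ck_on_add Ck_on_sum Ck_on_bilinear[OF bounded_bilinear_scaleR] Ck_on_const
      Ck_on_bilinear[OF bounded_bilinear_inner] Ck_on_bounded_linear bounded_linear_ident open_UNIV)

definition density_dom :: "'n \<Rightarrow> 'n trunc_poly set" where
  "density_dom j = {q. Re (decode q $ j $ j) \<noteq> 0}"

text \<open>If \<open>decode q\<close> is the projector of v, its (i, j) entry divided by its (j, j)
  entry is v_i / v_j. The diagonal entry is real, so its real part can serve as a real
  divisor.\<close>

definition density_chart :: "'n \<Rightarrow> 'n trunc_poly \<Rightarrow> _" where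
  "density_chart j q = inverse (Re (decode q $ j $ j)) *\<^sub>R clear_coord j (column j (decode q))"

definition density_param :: "'n \<Rightarrow> _ \<Rightarrow> 'n trunc_poly" where
  "density_param j w = encode (projector (affine_point j w))"

lemma density_map_affine_line: "density_map lam (affine_line j w) = density_param j w"
  by (simp add: affine_line_def density_param_def density_map_span affine_point_nonzero)

lemma Ck_on_density_param: "Ck_on k UNIV (density_param j)"
  unfolding density_param_def[abs_def]
  by (intro Ck_on_encode Ck_on_projector Ck_on_affine_point affine_point_nonzero open_UNIV)

lemma Ck_on_diag: "Ck_on k UNIV (\<lambda>q. Re (decode q $ j $ j))"
proof -
  have "bounded_linear (\<lambda>A :: complex ^ 'n::{card2, linorder} ^ 'n::{card2, linorder}. Re (A $ j $ j))"
    unfolding linear_conv_bounded_linear[symmetric] by (rule linearI) simp_all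
  then show ?thesis
    by (rule Ck_on_bounded_linear_compose[OF _ open_UNIV Ck_on_decode])
qed

lemma open_density_dom: "open (density_dom j)"
proof -
  have "continuous_on UNIV (\<lambda>q. Re (decode q $ j $ j))"
    using Ck_on_diag by (rule Ck_on_imp_continuous_on)
  then have "open ((\<lambda>q. Re (decode q $ j $ j)) -` (- {0}))"
    by (intro open_vimage) auto
  then show ?thesis
    by (simp add: density_dom_def vimage_def)
qed

lemma Ck_on_density_chart: "Ck_on k (density_dom j) (density_chart j)"
proof -
  have "bounded_linear (\<lambda>A :: complex ^ 'n::{card2, linorder} ^ 'n::{card2, linorder}. clear_coord j (column j A))"
    unfolding linear_conv_bounded_linear[symmetric]
    by (rule linearI) (simp_all add: clear_coord_def column_def vec_eq_iff)
  then have "Ck_on k UNIV (\<lambda>q. clear_coord j (column j (decode q)))"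
    by (rule Ck_on_bounded_linear_compose[OF _ open_UNIV Ck_on_decode])
  then have "Ck_on k (density_dom j) (\<lambda>q. clear_coord j (column j (decode q)))"
    by (rule Ck_on_subset) simp
  moreover have "Ck_on k (density_dom j) (\<lambda>q. inverse (Re (decode q $ j $ j)))"
    by (rule Ck_on_inverse[OF open_density_dom _ Ck_on_subset[OF Ck_on_diag]]) (auto simp: density_dom_def)
  ultimately show ?thesis
    unfolding density_chart_def[abs_def]
    by (intro Ck_on_bilinear[OF bounded_bilinear_scaleR open_density_dom])
qed

text \<open>The (j, j) entry of the projector of v is |v_j|^2 / |v|^2, so the open set
  \<open>density_dom j\<close> cuts exactly the affine chart out of the image.\<close>

lemma density_map_in_dom_iff:
  assumes "L \<in> proj_space"
  shows "density_map lam L \<in> density_dom j \<longleftrightarrow> L \<in> affine_dom j"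
proof -
  obtain v where v: "v \<noteq> 0" "L = vec.span {v}"
    using assms by (rule proj_space_cases)
  have "Re (projector v $ j $ j) = inverse (v \<bullet> v) * (cmod (v $ j))\<^sup>2"
    unfolding projector_nth complex_norm_square[symmetric] of_real_mult[symmetric] by (rule Re_complex_of_real)
  then show ?thesis
    using v by (simp add: density_dom_def decode_density_map mem_affine_dom)
qed

text \<open>The identity holds on the whole ambient space, not just where \<open>w $ j = 0\<close>,
  so it can be differentiated there; this is how the immersion property is obtained.\<close>

lemma density_chart_param: "density_chart j (density_param j w) = clear_coord j w"
proof -
  define r where "r = inverse (affine_point j w \<bullet> affine_point j w)"
  have "r \<noteq> 0"
    by (simp add: r_def affine_point_nonzero)
  have "decode (density_param j w) = projector (affine_point j w)"
    by (simp add: density_param_def decode_encode hermitian_projector projector_inner_mat_1 affine_point_nonzero)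
  then have "decode (density_param j w) $ i $ j = of_real r * (if i = j then 1 else w $ i)" for i
    by (simp only: projector_nth r_def[symmetric]) simp
  then show ?thesis
    using \<open>r \<noteq> 0\<close> by (simp add: density_chart_def vec_eq_iff clear_coord_def column_def
        scaleR_conv_of_real[where 'a = complex])
qed

lemma density_image_Int_dom: "density_map lam ` proj_space \<inter> density_dom j = density_param j ` {w. w $ j = 0}"
proof (intro set_eqI iffI)
  fix q assume "q \<in> density_map lam ` proj_space \<inter> density_dom j"
  then obtain L where "L \<in> affine_dom j" "q = density_map lam L"
    using density_map_in_dom_iff by blast
  then obtain w where "w $ j = 0" "L = affine_line j w"
    using affine_domE by blast
  then show "q \<in> density_param j ` {w. w $ j = 0}"
    using \<open>q = density_map lam L\<close> by (simp add: density_map_affine_line)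
next
  fix q assume "q \<in> density_param j ` {w. w $ j = 0}"
  then obtain w where "q = density_map lam (affine_line j w)"
    by (auto simp: density_map_affine_line)
  then show "q \<in> density_map lam ` proj_space \<inter> density_dom j"
    by (simp add: affine_line_in_proj_space density_map_in_dom_iff affine_line_in_affine_dom)
qed

lemma density_chart_image:
  "density_chart j ` (density_map lam ` proj_space \<inter> density_dom j) = {w. w $ j = 0}"
  unfolding density_image_Int_dom image_image density_chart_param by (auto simp: clear_coord_idem)

lemma density_param_chart:
  assumes "q \<in> density_map lam ` proj_space \<inter> density_dom j"
  shows "density_param j (density_chart j q) = q"
  using assms unfolding density_image_Int_dom by (auto simp: density_chart_param clear_coord_idem)

lemma inj_on_density_chart: "inj_on (density_chart j) (density_map lam ` proj_space \<inter> density_dom j)"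
  by (rule inj_on_inverseI) (rule density_param_chart)

lemma smooth_on_density_chart: "smooth_on (density_map lam ` proj_space \<inter> density_dom j) (density_chart j)"
  by (rule smooth_onI[OF open_density_dom _ Ck_on_density_chart]) auto

text \<open>Charts in \<open>submanifold_atlas\<close> take values in the ambient space of the
  submanifold. The chart into the complex model space is therefore followed by a linear isomorphism
  \<open>f\<close> onto a subspace \<open>T\<close> of the algebra, with linear inverse
  \<open>g\<close>.\<close>

lemma submanifold_atlas_density_image:
  obtains \<phi> where "(density_map lam ` proj_space \<inter> density_dom j, \<phi>) \<in>
     submanifold_atlas (2 * CARD('n) - 2) (density_map lam ` proj_space)"
proof -
  define U where "U = density_map lam ` proj_space \<inter> density_dom j"
  \<comment> \<open>The algebra has room for such a subspace because N \<ge> 2 gives 2N \<le>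
    N^2.\<close>
  have "2 * CARD('n) - 2 \<le> dim (UNIV :: 'n trunc_poly set)"
    unfolding dim_UNIV DIM_trunc_poly power2_eq_square
    using mult_le_mono1[OF two_le_card[where 'a = 'n], of "CARD('n)"] by linarith
  then obtain T :: "'n trunc_poly set" where T: "subspace T" "dim T = 2 * CARD('n) - 2"
    by (rule choose_subspace_of_subspace)
  have "dim {w :: complex ^ 'n::{card2, linorder}. w $ j = 0} = dim T"
    by (simp add: dim_coord_zero T(2))
  then obtain f :: "complex ^ 'n::{card2, linorder} \<Rightarrow> 'n trunc_poly" and g
    where "linear f" "linear g" "f ` {w. w $ j = 0} = T" "g ` T = {w. w $ j = 0}"
    "\<And>w. w \<in> {w. w $ j = 0} \<Longrightarrow> g (f w) = w" "\<And>t. t \<in> T \<Longrightarrow> f (g t) = t"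
  proof (rule isometries_subspaces[OF subspace_coord_zero[of j] T(1)])
    fix f :: "complex ^ 'n::{card2, linorder} \<Rightarrow> 'n trunc_poly" and g
    assume "linear f" "linear g" "f ` {w. w $ j = 0} = T" "g ` T = {w. w $ j = 0}"
      "\<And>w. w \<in> {w. w $ j = 0} \<Longrightarrow> g (f w) = w" "\<And>t. t \<in> T \<Longrightarrow> f (g t) = t"
    show thesis
      by (rule that[of f g]) fact+
  qed
  note f = this(1,3,5) and g = this(2,4,6)
  have inj: "inj_on (f \<circ> density_chart j) U"
    unfolding U_def
    by (rule comp_inj_on[OF inj_on_density_chart]) (rule inj_on_inverseI[of _ g], simp only: density_chart_image f(3))
  have image: "(f \<circ> density_chart j) ` U = T"
    unfolding U_def image_comp[symmetric] density_chart_image by (rule f(2))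
  have inv: "inv_into U (f \<circ> density_chart j) t = density_param j (g t)" if "t \<in> T" for t
  proof (rule inv_into_f_eq[OF inj])
    have gt: "g t \<in> {w. w $ j = 0}"
      using g(2) that by blast
    then show "density_param j (g t) \<in> U"
      unfolding U_def density_image_Int_dom by (rule imageI)
    show "(f \<circ> density_chart j) (density_param j (g t)) = t"
      using gt g(3)[OF that] by (simp add: density_chart_param clear_coord_idem)
  qed
  have "(U, f \<circ> density_chart j) \<in> submanifold_atlas (2 * CARD('n) - 2) (density_map lam ` proj_space)"
    unfolding submanifold_atlas_def mem_Collect_eq prod.case image
  proof (intro exI[of _ T] conjI T inj openin_subtopology_self)
    show "openin (top_of_set (density_map lam ` proj_space)) U"
      unfolding U_def by (rule openin_open_Int[OF open_density_dom])
    show "smooth_on U (f \<circ> density_chart j)"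
    proof (rule smooth_onI[OF open_density_dom[of j]])
      show "Ck_on k (density_dom j) (\<lambda>q. f (density_chart j q))" for k
        by (rule Ck_on_bounded_linear_compose[OF _ open_density_dom Ck_on_density_chart])
          (simp add: f(1) flip: linear_conv_bounded_linear)
    qed (simp_all add: U_def)
    show "smooth_on T (inv_into U (f \<circ> density_chart j))"
    proof (rule smooth_onI[OF open_UNIV subset_UNIV])
      show "Ck_on k UNIV (\<lambda>t. density_param j (g t))" for k
        by (rule Ck_on_compose[OF open_UNIV subset_UNIV Ck_on_bounded_linear Ck_on_density_param])
          (simp_all add: g(1) flip: linear_conv_bounded_linear)
    qed (simp add: inv)
  qed
  then show thesis
    using that unfolding U_def by blast
qed

lemma proj_space_affine_dom:
  assumes "L \<in> proj_space"
  obtains j where "L \<in> affine_dom j"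
proof -
  obtain v where v: "v \<noteq> 0" "L = vec.span {v}"
    using assms by (rule proj_space_cases)
  then obtain j where "v $ j \<noteq> 0"
    by (auto simp: vec_eq_iff)
  then show thesis
    using v that by (simp add: mem_affine_dom)
qed

lemma embedded_submanifold_density_image:
  "embedded_submanifold (2 * CARD('n) - 2) (density_map lam ` proj_space)"
  unfolding embedded_submanifold_def
proof
  fix q assume "q \<in> density_map lam ` proj_space"
  then obtain L where L: "L \<in> proj_space" "q = density_map lam L"
    by blast
  obtain j where "L \<in> affine_dom j"
    using L(1) by (rule proj_space_affine_dom)
  then have "q \<in> density_map lam ` proj_space \<inter> density_dom j"
    using L density_map_in_dom_iff by blast
  moreover obtain \<phi> where \<phi>: "(density_map lam ` proj_space \<inter> density_dom j, \<phi>) \<in>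
      submanifold_atlas (2 * CARD('n) - 2) (density_map lam ` proj_space)"
    by (rule submanifold_atlas_density_image)
  ultimately show "q \<in> \<Union> (fst ` submanifold_atlas (2 * CARD('n) - 2) (density_map lam ` proj_space))"
    using imageI[OF \<phi>, of fst] by auto
qed

text \<open>Lines with equal images lie in a common affine chart, since \<open>density_dom j\<close>
  detects this from the image; \<open>density_chart j\<close> then recovers the affine
  coordinate.\<close>

lemma inj_on_density_map: "inj_on (density_map lam) proj_space"
proof (rule inj_onI)
  fix L L' assume L: "L \<in> proj_space" "L' \<in> proj_space" and eq: "density_map lam L = density_map lam L'"
  obtain j where j: "L \<in> affine_dom j"
    using L(1) by (rule proj_space_affine_dom)
  then have "L' \<in> affine_dom j"
    using density_map_in_dom_iff[OF L(1), of j] density_map_in_dom_iff[OF L(2), of j] eq by simp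
  obtain w where w: "w $ j = 0" "L = affine_line j w"
    using j by (rule affine_domE)
  obtain w' where w': "w' $ j = 0" "L' = affine_line j w'"
    using \<open>L' \<in> affine_dom j\<close> by (rule affine_domE)
  have "density_param j w = density_param j w'"
    using eq unfolding w(2) w'(2) density_map_affine_line .
  then have "clear_coord j w = clear_coord j w'"
    unfolding density_chart_param[symmetric] by (rule arg_cong)
  then show "L = L'"
    unfolding w(2) w'(2) clear_coord_idem[OF w(1)] clear_coord_idem[OF w'(1)] by (rule arg_cong)
qed

end

section \<open>The topology of projective space\<close>

lemma proj_space_unit_cases:
  assumes "L \<in> (proj_space :: (complex ^ 'n) set set)"
  obtains v where "norm v = 1" "L = vec.span {v}"
proof -
  obtain u where u: "u \<noteq> 0" "L = vec.span {u}"
    using assms by (rule proj_space_cases)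
  define c :: complex where "c = of_real (inverse (norm u))"
  have "c \<noteq> 0"
    using u by (simp add: c_def)
  then have "vec.span {c *s u} = vec.span {u}"
    by (simp add: vec.span_image_scale[of "{u}" "\<lambda>_. c", simplified])
  moreover have "norm (c *s u) = 1"
    using u by (simp add: norm_vec_scale_complex c_def norm_inverse)
  ultimately show thesis
    using that u by blast
qed

lemma continuous_map_span: "continuous_map (top_of_set (sphere 0 1)) proj_topology (\<lambda>v :: complex ^ 'n. vec.span {v})"
  unfolding continuous_map_def
proof (intro conjI allI impI)
  show "(\<lambda>v :: complex ^ 'n. vec.span {v}) \<in> topspace (top_of_set (sphere 0 1)) \<rightarrow> topspace proj_topology"
    by (auto simp: topspace_proj_topology intro!: span_singleton_in_proj_space)
  fix W :: "(complex ^ 'n) set set" assume "openin proj_topology W"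
  then have "open {v. v \<noteq> 0 \<and> vec.span {v} \<in> W}"
    by (simp add: openin_proj_topology)
  then have "openin (top_of_set (sphere 0 1)) (sphere 0 1 \<inter> {v. v \<noteq> 0 \<and> vec.span {v} \<in> W})"
    by (rule openin_open_Int)
  moreover have "sphere 0 1 \<inter> {v. v \<noteq> 0 \<and> vec.span {v} \<in> W} =
      {v \<in> topspace (top_of_set (sphere 0 1)). vec.span {v} \<in> W}"
    by auto
  ultimately show "openin (top_of_set (sphere 0 1)) {v \<in> topspace (top_of_set (sphere 0 1)). vec.span {v} \<in> W}"
    by simp
qed

text \<open>Every line contains a unit vector, so the space is a continuous image of the compact
  unit sphere.\<close>

lemma compact_space_proj_topology: "compact_space (proj_topology :: (complex ^ 'n) set topology)"
proof -
  have "compactin (top_of_set (sphere 0 1 :: (complex ^ 'n) set)) (sphere 0 1)"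
    by (simp add: compactin_subtopology)
  then have "compactin proj_topology ((\<lambda>v :: complex ^ 'n. vec.span {v}) ` sphere 0 1)"
    using continuous_map_span by (rule image_compactin)
  moreover have "(\<lambda>v :: complex ^ 'n. vec.span {v}) ` sphere 0 1 = proj_space"
  proof (intro equalityI subsetI)
    fix L :: "(complex ^ 'n) set" assume "L \<in> proj_space"
    then show "L \<in> (\<lambda>v. vec.span {v}) ` sphere 0 1"
      by (rule proj_space_unit_cases) simp
  next
    fix L assume "L \<in> (\<lambda>v :: complex ^ 'n. vec.span {v}) ` sphere 0 1"
    then show "L \<in> proj_space"
      by (auto intro!: span_singleton_in_proj_space)
  qed
  ultimately show ?thesis
    by (simp add: compact_space_def topspace_proj_topology)
qed

section \<open>Topological embedding and algebraic equations of the image\<close>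

context gell_mann_numbering
begin

text \<open>By the quotient topology it is enough that \<open>encode (projector v)\<close> is
  continuous in the nonzero vector \<open>v\<close>.\<close>

lemma continuous_map_density_map: "continuous_map proj_topology euclidean (density_map lam)"
  unfolding continuous_map_def
proof (intro conjI allI impI)
  fix W :: "'n trunc_poly set" assume "openin euclidean W"
  then have "open W"
    by simp
  have "continuous_on (- {0}) (\<lambda>v. encode (projector v))"
    by (rule Ck_on_imp_continuous_on[of 0], rule Ck_on_encode[OF _ Ck_on_projector[OF _ _ Ck_on_bounded_linear]])
      (simp_all add: open_Compl bounded_linear_ident)
  then have "open (- {0} \<inter> (\<lambda>v. encode (projector v)) -` W)"
    using \<open>open W\<close> by (intro continuous_open_preimage) (simp_all add: open_Compl)
  moreover have "- {0} \<inter> (\<lambda>v. encode (projector v)) -` W =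
      {v. v \<noteq> 0 \<and> vec.span {v} \<in> {L \<in> topspace proj_topology. density_map lam L \<in> W}}"
    by (auto simp: topspace_proj_topology density_map_span span_singleton_in_proj_space)
  ultimately show "openin proj_topology {L \<in> topspace proj_topology. density_map lam L \<in> W}"
    by (simp add: openin_proj_topology topspace_proj_topology)
qed simp

text \<open>A continuous map from a compact space to a Hausdorff space is closed, and an injective
  continuous closed map is an embedding.\<close>

lemma embedding_map_density_map: "embedding_map proj_topology euclidean (density_map lam)"
proof (rule injective_closed_imp_embedding_map[OF continuous_map_density_map])
  show "closed_map proj_topology euclidean (density_map lam)"
    by (rule T1_Spaces.continuous_imp_closed_map[OF continuous_map_density_map compact_space_proj_topology
        Hausdorff_space_euclidean])
qed (simp add: topspace_proj_topology inj_on_density_map)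

lemma compact_density_image: "compact (density_map lam ` proj_space)"
  using image_compactin[OF compact_space_proj_topology[unfolded compact_space_def] continuous_map_density_map]
  by (simp add: topspace_proj_topology)

lemma real_polynomial_function_decode:
  "real_polynomial_function (\<lambda>q. Re (decode q $ a $ b))" "real_polynomial_function (\<lambda>q. Im (decode q $ a $ b))"
proof -
  let ?c = "of_real (1 / real CARD('n)) :: 'n trunc_poly"
  have "real_polynomial_function (\<lambda>q :: 'n trunc_poly. (q - ?c) \<bullet> eps ^ (i - 1))" for i
    unfolding inner_diff_left
    by (intro real_polynomial_function_diff real_polynomial_function.intros(1)[OF bounded_linear_inner_left]
        real_polynomial_function.intros(2))
  then have affine: "real_polynomial_function (\<lambda>q :: 'n trunc_poly.
      x + s * (\<Sum>i = 1..CARD('n)\<^sup>2 - 1. ((q - ?c) \<bullet> eps ^ (i - 1)) * y i))" for x s y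
    by (intro real_polynomial_function.intros(3) real_polynomial_function.intros(4) real_polynomial_function_sum
        real_polynomial_function.intros(2) finite_atLeastAtMost)
  have "Re (decode q $ a $ b) = Re (mat 1 $ a $ b) / real CARD('n) +
      bloch_scale * (\<Sum>i = 1..CARD('n)\<^sup>2 - 1. ((q - ?c) \<bullet> eps ^ (i - 1)) * Re (lam i $ a $ b))"
    and "Im (decode q $ a $ b) = Im (mat 1 $ a $ b) / real CARD('n) +
      bloch_scale * (\<Sum>i = 1..CARD('n)\<^sup>2 - 1. ((q - ?c) \<bullet> eps ^ (i - 1)) * Im (lam i $ a $ b))" for q
    by (simp_all add: decode_def)
  then show "real_polynomial_function (\<lambda>q. Re (decode q $ a $ b))" "real_polynomial_function (\<lambda>q. Im (decode q $ a $ b))"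
    by (simp_all only: affine)
qed

text \<open>Each complex minor contributes two real equations, its real and imaginary parts. The
  equations are finite in number because the index quadruples are.\<close>

lemma real_algebraic_density_image: "real_algebraic_set (density_map lam ` proj_space)"
proof -
  define m where "m = (\<lambda>(a, b, c, d) q. decode q $ a $ b * decode q $ c $ d - decode q $ a $ d * decode q $ c $ b)"
  have "real_polynomial_function (\<lambda>q. Re (m x q))" "real_polynomial_function (\<lambda>q. Im (m x q))" for x
    unfolding m_def case_prod_beta minus_complex.sel times_complex.sel
    by (intro real_polynomial_function_diff real_polynomial_function.intros(3) real_polynomial_function.intros(4)
        real_polynomial_function_decode)+
  then have "\<forall>p\<in>range (\<lambda>x q. Re (m x q)) \<union> range (\<lambda>x q. Im (m x q)). real_polynomial_function p"
    by blast
  moreover have "finite (range (\<lambda>x q. Re (m x q)) \<union> range (\<lambda>x q. Im (m x q)))"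
    by simp
  moreover have "density_map lam ` proj_space =
      {q. \<forall>p\<in>range (\<lambda>x q. Re (m x q)) \<union> range (\<lambda>x q. Im (m x q)). p q = 0}"
  proof -
    have "(\<forall>p\<in>range (\<lambda>x q. Re (m x q)) \<union> range (\<lambda>x q. Im (m x q)). p q = 0) \<longleftrightarrow> (\<forall>x. m x q = 0)" for q
      by (auto simp: ball_Un complex_eq_iff)
    moreover have "(\<forall>x. m x q = 0) \<longleftrightarrow> q \<in> density_map lam ` proj_space" for q
      by (simp add: density_image_iff_minors m_def split_paired_All)
    ultimately show ?thesis
      by (simp only: Collect_mem_eq)
  qed
  ultimately show ?thesis
    unfolding real_algebraic_set_def by blast
qed

section \<open>Smoothness in charts and the immersion property\<close>

lemma density_map_inv_into:
  assumes "w $ j = 0"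
  shows "(density_map lam \<circ> inv_into (affine_dom j) (affine_coord j)) w = density_param j w"
  by (simp add: inv_into_affine_coord[OF assms] density_map_affine_line)

lemma smooth_on_density_map_inv_into:
  assumes "A \<subseteq> affine_dom j"
  shows "smooth_on (affine_coord j ` A) (density_map lam \<circ> inv_into (affine_dom j) (affine_coord j))"
proof (rule smooth_onI[OF open_UNIV subset_UNIV Ck_on_density_param])
  fix w assume "w \<in> affine_coord j ` A"
  then have "w $ j = 0"
    using image_mono[OF assms, of "affine_coord j"] affine_coord_image by blast
  then show "density_param j w = (density_map lam \<circ> inv_into (affine_dom j) (affine_coord j)) w"
    by (simp only: density_map_inv_into)
qed

text \<open>If D and E are the derivatives of parametrisation and chart, the chain rule gives
  \<open>E \<circ> D = clear_coord j\<close>. On the tangent space \<open>w $ j = 0\<close> this is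
  the identity, so E is a left inverse of D there.\<close>

lemma immersion_density_map: "immersion proj_atlas (density_map lam)"
  unfolding immersion_def
proof safe
  fix U L and \<phi> :: "(complex ^ 'n::{card2, linorder}) set \<Rightarrow> complex ^ 'n::{card2, linorder}"
  assume "(U, \<phi>) \<in> proj_atlas" and L: "L \<in> U"
  then obtain j where j: "U = affine_dom j" "\<phi> = affine_coord j"
    by (auto simp: proj_atlas_def)
  define w where "w = affine_coord j L"
  have w: "w $ j = 0"
    using L affine_coord_image[of j] unfolding w_def j by blast
  define D where "D = frechet_derivative (density_param j) (at w)"
  have D: "(density_param j has_derivative D) (at w)"
    unfolding D_def using Ck_on_SucD[OF Ck_on_density_param] by blast
  have "density_param j w \<in> density_dom j"
    using w density_image_Int_dom[of j] by blast
  then obtain E where E: "(density_chart j has_derivative E) (at (density_param j w))"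
    using Ck_on_SucD[OF Ck_on_density_chart] by blast
  have "((density_chart j \<circ> density_param j) has_derivative (E \<circ> D)) (at w)"
    using D E by (rule diff_chain_at)
  moreover have "density_chart j \<circ> density_param j = clear_coord j"
    by (rule ext) (simp add: density_chart_param)
  moreover have "(clear_coord j has_derivative clear_coord j) (at w)"
    by (rule bounded_linear_imp_has_derivative) (simp add: linear_clear_coord flip: linear_conv_bounded_linear)
  ultimately have ED: "E \<circ> D = clear_coord j"
    using has_derivative_unique by metis
  have "inj_on D {w. w $ j = 0}"
  proof (rule inj_on_inverseI)
    show "E (D v) = v" if "v \<in> {w. w $ j = 0}" for v
      using fun_cong[OF ED, of v] that by (simp add: clear_coord_idem)
  qed
  moreover have "(density_map lam \<circ> inv_into (affine_dom j) (affine_coord j) has_derivative D) (at w within {w. w $ j = 0})"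
    by (rule has_derivative_transform[OF _ _ has_derivative_at_withinI[OF D]])
      (use w in \<open>simp_all only: mem_Collect_eq density_map_inv_into\<close>)
  ultimately show "\<exists>D. (density_map lam \<circ> inv_into U \<phi> has_derivative D) (at (\<phi> L) within \<phi> ` U) \<and>
      inj_on D (span (\<phi> ` U))"
    unfolding j affine_coord_image span_eq_iff[THEN iffD2, OF subspace_coord_zero] w_def by blast
qed

lemma smooth_embedding_density_map: "smooth_embedding proj_topology proj_atlas (density_map lam)"
  unfolding smooth_embedding_def smooth_map_def
proof (intro conjI continuous_map_density_map immersion_density_map embedding_map_density_map)
  show "\<forall>(U, \<phi>)\<in>proj_atlas. \<forall>(V, \<psi>)\<in>{(UNIV, id)}.
      smooth_on (\<phi> ` (U \<inter> density_map lam -` V)) (\<psi> \<circ> density_map lam \<circ> inv_into U \<phi>)"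
    by (auto simp: proj_atlas_def smooth_on_density_map_inv_into[OF subset_refl])
qed

text \<open>The image itself attains the value. For the upper bound, the inverse of a chart of
  \<open>M\<close> followed by \<open>density_chart j\<close> is a continuous injection from a
  nonempty open subset of a d-dimensional space into the model space.\<close>

lemma real_dimension_density_image: "real_dimension (density_map lam ` proj_space) = 2 * CARD('n) - 2"
proof -
  define V where "V = density_map lam ` proj_space"
  have le: "d \<le> 2 * CARD('n) - 2" if M: "M \<subseteq> V" "M \<noteq> {}" "embedded_submanifold d M" for d M
  proof -
    obtain q where "q \<in> M"
      using M by blast
    then obtain U \<phi> where "(U, \<phi>) \<in> submanifold_atlas d M" "q \<in> U"
      using M(3) unfolding embedded_submanifold_def by fastforce
    then obtain S where S: "subspace S" "dim S = d" "openin (top_of_set M) U" "openin (top_of_set S) (\<phi> ` U)"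
        "inj_on \<phi> U" "smooth_on (\<phi> ` U) (inv_into U \<phi>)"
      unfolding submanifold_atlas_def by blast
    have U: "U \<subseteq> V"
      using openin_imp_subset[OF S(3)] M(1) by blast
    then obtain L where L: "L \<in> proj_space" "q = density_map lam L"
      using \<open>q \<in> U\<close> unfolding V_def by blast
    obtain j where "L \<in> affine_dom j"
      using L(1) by (rule proj_space_affine_dom)
    then have q: "q \<in> density_dom j"
      using L density_map_in_dom_iff by blast
    define g where "g = inv_into U \<phi>"
    have g: "g (\<phi> x) = x" if "x \<in> U" for x
      unfolding g_def using S(5) that by (rule inv_into_f_f)
    have cont_g: "continuous_on (\<phi> ` U) g"
      unfolding g_def using S(6) by (rule smooth_on_imp_continuous_on)
    \<comment> \<open>The chart domain is cut down to the points whose images lie in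
      \<open>density_dom j\<close>; it stays open in \<open>S\<close> because \<open>g\<close> is
      continuous, and it contains \<open>\<phi> q\<close>.\<close>
    define A where "A = \<phi> ` U \<inter> g -` density_dom j"
    have A: "g x \<in> V \<inter> density_dom j" if "x \<in> A" for x
      using that U g unfolding A_def by auto
    have "dim S \<le> dim {w :: complex ^ 'n::{card2, linorder}. w $ j = 0}"
    proof (rule invariance_of_dimension_subspaces)
      have "openin (top_of_set (\<phi> ` U)) A"
        unfolding A_def using cont_g open_density_dom by (rule continuous_openin_preimage_gen)
      then show "openin (top_of_set S) A"
        using S(4) by (rule openin_trans)
      show "continuous_on A (density_chart j \<circ> g)"
      proof (rule continuous_on_compose)
        show "continuous_on A g"
          using cont_g by (rule continuous_on_subset) (simp add: A_def)
        show "continuous_on (g ` A) (density_chart j)"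
          by (rule continuous_on_subset[OF Ck_on_imp_continuous_on[OF Ck_on_density_chart[of 0]]])
            (use A in blast)
      qed
      show "density_chart j \<circ> g \<in> A \<rightarrow> {w. w $ j = 0}"
        using A density_chart_image[of j] unfolding V_def by auto
      show "inj_on (density_chart j \<circ> g) A"
      proof (rule comp_inj_on)
        show "inj_on g A"
          using g unfolding A_def by (auto intro!: inj_on_inverseI[of _ \<phi>])
        show "inj_on (density_chart j) (g ` A)"
          by (rule inj_on_subset[OF inj_on_density_chart[of j]]) (use A V_def in blast)
      qed
      show "A \<noteq> {}"
        using \<open>q \<in> U\<close> q g unfolding A_def by force
    qed (simp_all add: S subspace_coord_zero)
    then show ?thesis
      by (simp add: S dim_coord_zero)
  qed
  have "V \<noteq> {}"
    using affine_line_in_proj_space unfolding V_def by blast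
  show ?thesis
    unfolding real_dimension_def V_def[symmetric]
  \<comment> \<open>\<open>Max\<close> is meaningful only on a finite set; the upper bound supplies
    the finiteness as well.\<close>
  proof (rule Max_eqI)
    show "finite {d. \<exists>M\<subseteq>V. M \<noteq> {} \<and> embedded_submanifold d M}"
      by (rule finite_subset[of _ "{..2 * CARD('n) - 2}"]) (use le in blast, simp)
    show "2 * CARD('n) - 2 \<in> {d. \<exists>M\<subseteq>V. M \<noteq> {} \<and> embedded_submanifold d M}"
      using embedded_submanifold_density_image \<open>V \<noteq> {}\<close> unfolding V_def by blast
  qed (use le in blast)
qed

section \<open>The inverse map and the diffeomorphism\<close>

lemma continuous_map_inv_density_map:
  "continuous_map (top_of_set (density_map lam ` proj_space)) proj_topology (inv_into proj_space (density_map lam))"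
proof -
  have "homeomorphic_map proj_topology (top_of_set (density_map lam ` proj_space)) (density_map lam)"
    using embedding_map_density_map by (simp add: embedding_map_def topspace_proj_topology)
  then obtain g where g: "homeomorphic_maps proj_topology (top_of_set (density_map lam ` proj_space)) (density_map lam) g"
    unfolding homeomorphic_map_maps by blast
  then have cont: "continuous_map (top_of_set (density_map lam ` proj_space)) proj_topology g"
    and g: "\<And>L. L \<in> proj_space \<Longrightarrow> g (density_map lam L) = L"
    unfolding homeomorphic_maps_def topspace_proj_topology by blast+
  show ?thesis
  proof (rule continuous_map_eq[OF cont])
    show "g q = inv_into proj_space (density_map lam) q"
      if "q \<in> topspace (top_of_set (density_map lam ` proj_space))" for q
      using that g by (auto simp: inv_into_f_f[OF inj_on_density_map])
  qed
qed

text \<open>In an affine chart the inverse of the density map is \<open>density_chart j\<close>, the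
  restriction of a map smooth on an open subset of the algebra.\<close>

lemma affine_coord_inv_density_map:
  assumes "q \<in> density_map lam ` proj_space \<inter> density_dom j"
  shows "affine_coord j (inv_into proj_space (density_map lam) q) = density_chart j q"
proof -
  obtain w where w: "w $ j = 0" "q = density_param j w"
    using assms unfolding density_image_Int_dom by blast
  have "inv_into proj_space (density_map lam) q = affine_line j w"
    unfolding w(2) density_map_affine_line[symmetric]
    by (rule inv_into_f_f[OF inj_on_density_map affine_line_in_proj_space])
  then show ?thesis
    by (simp add: affine_coord_affine_line w density_chart_param clear_coord_idem)
qed

text \<open>An arbitrary chart \<psi> of the image has to be handled. Forwards, \<psi> is composed
  with the smooth parametrisation; backwards, the smooth inverse of \<psi> is followed by
  \<open>density_chart j\<close>. No compatibility between charts of the image is invoked.\<close>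

lemma diffeomorphism_density_map:
  "diffeomorphism proj_topology proj_atlas (top_of_set (density_map lam ` proj_space))
     (submanifold_atlas d (density_map lam ` proj_space)) (density_map lam)"
  unfolding diffeomorphism_def topspace_proj_topology topspace_euclidean_subtopology
proof (intro conjI)
  define V where "V = density_map lam ` proj_space"
  show "bij_betw (density_map lam) proj_space (density_map lam ` proj_space)"
    using inj_on_density_map by (rule inj_on_imp_bij_betw)
  show "smooth_map proj_topology proj_atlas (top_of_set (density_map lam ` proj_space))
     (submanifold_atlas d (density_map lam ` proj_space)) (density_map lam)"
    unfolding smooth_map_def V_def[symmetric]
  proof safe
    show "continuous_map proj_topology (top_of_set V) (density_map lam)"
      using continuous_map_density_map by (auto simp: continuous_map_in_subtopology topspace_proj_topology V_def)
    fix U' U \<psi> and \<phi> :: "(complex ^ 'n::{card2, linorder}) set \<Rightarrow> complex ^ 'n::{card2, linorder}"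
    assume "(U', \<phi>) \<in> proj_atlas" and U: "(U, \<psi>) \<in> submanifold_atlas d V"
    then obtain j where j: "U' = affine_dom j" "\<phi> = affine_coord j"
      by (auto simp: proj_atlas_def)
    have \<psi>: "smooth_on U \<psi>"
      using U unfolding submanifold_atlas_def by blast
    show "smooth_on (\<phi> ` (U' \<inter> density_map lam -` U)) (\<psi> \<circ> density_map lam \<circ> inv_into U' \<phi>)"
      unfolding j comp_assoc
    proof (rule smooth_on_compose[OF smooth_on_density_map_inv_into \<psi>])
      show "(density_map lam \<circ> inv_into (affine_dom j) (affine_coord j)) `
          affine_coord j ` (affine_dom j \<inter> density_map lam -` U) \<subseteq> U"
        by (auto simp: inv_into_f_f[OF inj_on_affine_coord])
    qed simp
  qed
  show "smooth_map (top_of_set (density_map lam ` proj_space))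
     (submanifold_atlas d (density_map lam ` proj_space)) proj_topology proj_atlas
     (inv_into proj_space (density_map lam))"
    unfolding smooth_map_def
  proof safe
    show "continuous_map (top_of_set (density_map lam ` proj_space)) proj_topology (inv_into proj_space (density_map lam))"
      by (rule continuous_map_inv_density_map)
    fix U' U \<psi> and \<phi> :: "(complex ^ 'n::{card2, linorder}) set \<Rightarrow> complex ^ 'n::{card2, linorder}"
    assume "(U', \<phi>) \<in> proj_atlas" and "(U, \<psi>) \<in> submanifold_atlas d (density_map lam ` proj_space)"
    then obtain j where j: "U' = affine_dom j" "\<phi> = affine_coord j"
      by (auto simp: proj_atlas_def)
    have U: "U \<subseteq> V" and inj: "inj_on \<psi> U" and inv: "smooth_on (\<psi> ` U) (inv_into U \<psi>)"
      using \<open>(U, \<psi>) \<in> _\<close> openin_imp_subset unfolding submanifold_atlas_def V_def by blast+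
    define A where "A = \<psi> ` (U \<inter> inv_into proj_space (density_map lam) -` affine_dom j)"
    \<comment> \<open>These are the points where \<open>density_chart j\<close> is smooth and
      expresses the inverse in affine coordinates.\<close>
    have A: "inv_into U \<psi> x \<in> V \<inter> density_dom j" if x: "x \<in> A" for x
    proof -
      obtain q where q: "q \<in> U" "inv_into proj_space (density_map lam) q \<in> affine_dom j" "x = \<psi> q"
        using x unfolding A_def by blast
      then obtain L where L: "L \<in> proj_space" "q = density_map lam L"
        using U unfolding V_def by blast
      then have "q \<in> density_dom j"
        using q(2) density_map_in_dom_iff by (simp add: inv_into_f_f[OF inj_on_density_map])
      then show ?thesis
        using U q by (auto simp: inv_into_f_f[OF inj])
    qed
    have "smooth_on A (density_chart j \<circ> inv_into U \<psi>)"
    proof (rule smooth_on_compose[OF smooth_on_subset[OF inv] smooth_on_density_chart])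
      show "A \<subseteq> \<psi> ` U"
        unfolding A_def by blast
      show "inv_into U \<psi> ` A \<subseteq> density_map lam ` proj_space \<inter> density_dom j"
        using A unfolding V_def by blast
    qed
    moreover have "(density_chart j \<circ> inv_into U \<psi>) x =
        (affine_coord j \<circ> inv_into proj_space (density_map lam) \<circ> inv_into U \<psi>) x" if "x \<in> A" for x
      using affine_coord_inv_density_map[OF A[OF that, unfolded V_def]] by simp
    ultimately show "smooth_on (\<psi> ` (U \<inter> inv_into proj_space (density_map lam) -` U'))
        (\<phi> \<circ> inv_into proj_space (density_map lam) \<circ> inv_into U \<psi>)"
      unfolding j A_def[symmetric] using smooth_on_cong by blast
  qed
qed

end

theorem mainTheorem5:
  fixes lam :: "nat \<Rightarrow> complex ^ 'n::{card2, linorder} ^ 'n::{card2, linorder}"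
  assumes "bij_betw lam {1..CARD('n)\<^sup>2 - 1} gell_mann_matrices"
  defines "\<Psi> \<equiv> (density_map lam :: (complex ^ 'n::{card2, linorder}) set \<Rightarrow> 'n trunc_poly)"
  defines "V \<equiv> \<Psi> ` proj_space"
  shows "DIM('n trunc_poly) = CARD('n)\<^sup>2 - 1 \<and>
    inj_on \<Psi> proj_space \<and>
    smooth_embedding proj_topology proj_atlas \<Psi> \<and>
    compact V \<and> real_algebraic_set V \<and>
    embedded_submanifold (2 * CARD('n) - 2) V \<and> real_dimension V = 2 * CARD('n) - 2 \<and>
    diffeomorphism proj_topology proj_atlas
      (top_of_set V) (submanifold_atlas (2 * CARD('n) - 2) V) \<Psi>"
proof -
  interpret gell_mann_numbering lam
    by (rule gell_mann_numbering.intro) (rule assms(1))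
  show ?thesis
    unfolding V_def \<Psi>_def
    by (intro conjI DIM_trunc_poly inj_on_density_map smooth_embedding_density_map compact_density_image
        real_algebraic_density_image embedded_submanifold_density_image real_dimension_density_image
        diffeomorphism_density_map)
qed

end
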